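(* Let $p$ be a prime, $G$ an extraspecial $p$-group, and $i_G$ the number of word image impostors in $G$. (i) If $p=2$, then $i_G=1$ if $G$ is isomorphic to the quaternion group $Q_2$ of order $8$, and $i_G=5$ otherwise. (ii) If $p$ is odd, then $i_G=1$ if $\exp(G)=p$; $i_G=2^{p+1}-3$ if $\exp(G)=p^2$ and $|G|=p^3$; and $i_G=2^{p+2}-3$ if $\exp(G)=p^2$ and $|G|>p^3$.
   Context: A special $p$-group is a finite $p$-group whose center, derived subgroup and Frattini subgroup coincide and are elementary abelian; it is extraspecial if $|Z(G)|=p$. $F_d$ is the free group on $d$ letters; for $w\in F_d$, $w(G)$ is the image of the word map $G^d\to G$. A word image candidate is a subset $A\subseteq G$ with $1\in A$ and $\varphi(A)\subseteq A$ for all $\varphi\in\mathrm{Aut}(G)$. A word image impostor is a word image candidate that is not equal to $w(G)$ for any $d\ge1$, $w\in F_d$. *)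

theory Defs
  imports "HOL-Algebra.Algebra"
begin

definition group_center :: "('a, 'b) monoid_scheme \<Rightarrow> 'a set" where
  "group_center G = {z \<in> carrier G. \<forall>g \<in> carrier G. z \<otimes>\<^bsub>G\<^esub> g = g \<otimes>\<^bsub>G\<^esub> z}"

definition maximal_subgroup :: "'a set \<Rightarrow> ('a, 'b) monoid_scheme \<Rightarrow> bool" where
  "maximal_subgroup H G \<longleftrightarrow> subgroup H G \<and> H \<noteq> carrier G \<and>
     (\<forall>K. subgroup K G \<and> H \<subseteq> K \<longrightarrow> K = H \<or> K = carrier G)"

definition frattini :: "('a, 'b) monoid_scheme \<Rightarrow> 'a set" where
  "frattini G = carrier G \<inter> \<Inter> {H. maximal_subgroup H G}"

definition p_group :: "nat \<Rightarrow> ('a, 'b) monoid_scheme \<Rightarrow> bool" where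
  "p_group p G \<longleftrightarrow> group G \<and> finite (carrier G) \<and> (\<exists>n. card (carrier G) = p ^ n)"

definition elementary_abelian :: "nat \<Rightarrow> 'a set \<Rightarrow> ('a, 'b) monoid_scheme \<Rightarrow> bool" where
  "elementary_abelian p H G \<longleftrightarrow> subgroup H G \<and>
     (\<forall>x \<in> H. \<forall>y \<in> H. x \<otimes>\<^bsub>G\<^esub> y = y \<otimes>\<^bsub>G\<^esub> x) \<and>
     (\<forall>x \<in> H. x [^]\<^bsub>G\<^esub> p = \<one>\<^bsub>G\<^esub>)"

definition special_p_group :: "nat \<Rightarrow> ('a, 'b) monoid_scheme \<Rightarrow> bool" where
  "special_p_group p G \<longleftrightarrow> p_group p G \<and>
     group_center G = derived G (carrier G) \<and>
     derived G (carrier G) = frattini G \<and>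
     elementary_abelian p (group_center G) G"

definition extraspecial_p_group :: "nat \<Rightarrow> ('a, 'b) monoid_scheme \<Rightarrow> bool" where
  "extraspecial_p_group p G \<longleftrightarrow> special_p_group p G \<and> card (group_center G) = p"

definition group_exponent :: "('a, 'b) monoid_scheme \<Rightarrow> nat" where
  "group_exponent G = Lcm (group.ord G ` carrier G)"

text \<open>An element of the free group F_d is represented by a word: a list of letters
  (i, e) with i < d, where e = True means x_i and e = False means x_i^{-1}.
  Every element of F_d is represented by such a word, and the word map only depends on
  the group element represented.\<close>

definition is_word :: "nat \<Rightarrow> (nat \<times> bool) list \<Rightarrow> bool" where
  "is_word d w \<longleftrightarrow> (\<forall>l \<in> set w. fst l < d)"

fun word_eval :: "('a, 'b) monoid_scheme \<Rightarrow> (nat \<times> bool) list \<Rightarrow> (nat \<Rightarrow> 'a) \<Rightarrow> 'a" where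
  "word_eval G [] g = \<one>\<^bsub>G\<^esub>"
| "word_eval G ((i, e) # w) g =
     (if e then g i else inv\<^bsub>G\<^esub> (g i)) \<otimes>\<^bsub>G\<^esub> word_eval G w g"

definition word_image :: "('a, 'b) monoid_scheme \<Rightarrow> nat \<Rightarrow> (nat \<times> bool) list \<Rightarrow> 'a set" where
  "word_image G d w = {word_eval G w g | g. g \<in> {..<d} \<rightarrow> carrier G}"

definition word_image_candidate :: "('a, 'b) monoid_scheme \<Rightarrow> 'a set \<Rightarrow> bool" where
  "word_image_candidate G A \<longleftrightarrow> A \<subseteq> carrier G \<and> \<one>\<^bsub>G\<^esub> \<in> A \<and>
     (\<forall>\<phi> \<in> iso G G. \<phi> ` A \<subseteq> A)"

definition word_image_impostor :: "('a, 'b) monoid_scheme \<Rightarrow> 'a set \<Rightarrow> bool" where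
  "word_image_impostor G A \<longleftrightarrow> word_image_candidate G A \<and>
     \<not> (\<exists>d \<ge> 1. \<exists>w. is_word d w \<and> A = word_image G d w)"

definition num_impostors :: "('a, 'b) monoid_scheme \<Rightarrow> nat" where
  "num_impostors G = card {A. word_image_impostor G A}"

text \<open>(a, b) with a < 4, b < 2 represents i^a j^b, where i^4 = 1, j^2 = i^2, j i j^{-1} = i^{-1}.\<close>
definition quat_mult :: "nat \<times> nat \<Rightarrow> nat \<times> nat \<Rightarrow> nat \<times> nat" where
  "quat_mult x y = (case x of (a, b) \<Rightarrow> case y of (c, d) \<Rightarrow>
     if b = 0 then ((a + c) mod 4, d)
     else if d = 0 then ((a + 4 - c) mod 4, 1)
     else ((a + 4 - c + 2) mod 4, 0))"

definition quaternion_group :: "(nat \<times> nat) monoid" where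
  "quaternion_group = \<lparr>carrier = {0..<4} \<times> {0..<2}, monoid.mult = quat_mult, monoid.one = (0, 0)\<rparr>"

end

theory Submission
  imports Defs
begin

text \<open>The centre \<open>Z\<close> has order \<open>p\<close>, and commutation makes \<open>G/Z\<close> a nondegenerate symplectic space over
  the prime field. A word whose image is not contained in \<open>Z\<close> has a letter with exponent sum prime to
  \<open>p\<close>, and is then surjective; since \<open>Z - {1}\<close> is a single automorphism orbit, the word images
  are exactly \<open>{1}\<close>, \<open>Z\<close> and \<open>G\<close>. Word image candidates are unions of automorphism orbits containing \<open>{1}\<close>,
  so the number of impostors is \<open>2\<^sup>k\<^sup>-\<^sup>1 - 3\<close>, where \<open>k\<close> is the number of orbits.

  The orbits are found by lifting isometries of \<open>G/Z\<close>. For \<open>p = 2\<close> the form preserved is the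
  quadratic form \<open>x \<mapsto> x\<^sup>2\<close>, and noncentral elements are separated by their square alone. For odd \<open>p\<close> the
  map \<open>x \<mapsto> x\<^sup>p\<close> is a homomorphism, hence equal to \<open>[\<cdot>, u]\<close> for some \<open>u\<close>. If it is nontrivial,
  the noncentral orbits are the cosets \<open>u\<^sup>c Z\<close> with \<open>0 < c < p\<close>, the elements of order \<open>p\<^sup>2\<close>, and the remaining
  elements of order \<open>p\<close>, which exist precisely when \<open>|G| > p\<^sup>3\<close>.\<close>

text \<open>No classification of extraspecial groups and no Witt-type extension theorem is invoked:
  every automorphism is given by a formula on \<open>G\<close> itself, where centrality of
  commutators turns the homomorphism law into a computation. The obstacle is that a lifted
  transvection carries \<open>x\<close> to \<open>y\<close> only if the two do not commute and have
  the same \<open>p\<close>-th power. Commuting elements are therefore joined through a third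
  element \<open>w\<close> that commutes with neither; the difficulty is to give \<open>w\<close>
  the right \<open>p\<close>-th power as well. For \<open>p = 2\<close> this can fail, which is why
  a second kind of isometry appears. Transvections also fix \<open>Z\<close> pointwise, so for odd
  \<open>p\<close> moving central elements requires lifts of similitudes, built from a Lagrangian
  splitting. In the count, the exponent drops by 1 because the orbit of the identity is compulsory,
  and 3 is the number of word images. The value of \<open>k\<close> is 3 for the quaternion group
  and for odd exponent \<open>p\<close>, 4 for the other extraspecial 2-groups, and
  \<open>p + 2\<close> or \<open>p + 3\<close> for odd exponent \<open>p^2\<close>.\<close>

context group
begin

section \<open>Automorphism orbits and commutators in an arbitrary group\<close>

lemma inv_mult_cancel_left [simp]:
  "\<lbrakk>x \<in> carrier G; y \<in> carrier G\<rbrakk> \<Longrightarrow> inv x \<otimes> (x \<otimes> y) = y"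
  by (simp add: m_assoc [symmetric])

lemma mult_inv_cancel_left [simp]:
  "\<lbrakk>x \<in> carrier G; y \<in> carrier G\<rbrakk> \<Longrightarrow> x \<otimes> (inv x \<otimes> y) = y"
  by (simp add: m_assoc [symmetric])

text \<open>On a finite group injectivity gives surjectivity, so each map constructed later needs
  only the homomorphism law and its kernel.\<close>

lemma iso_self_if_trivial_kernel:
  assumes "finite (carrier G)" "h \<in> hom G G"
    and "\<And>x. \<lbrakk>x \<in> carrier G; h x = \<one>\<rbrakk> \<Longrightarrow> x = \<one>"
  shows "h \<in> iso G G"
proof -
  interpret h: group_hom G G h
    by (simp add: assms(2) group_hom_axioms_def group_hom_def)
  have "inj_on h (carrier G)"
    using assms(3) by (simp add: h.inj_on_one_iff)
  then show ?thesis
    using assms(1,2) endo_inj_surj[OF assms(1), of h] unfolding iso_def bij_betw_def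
    by (auto simp: hom_def Pi_iff image_subset_iff)
qed

lemma iso_self_inverse:
  assumes "\<phi> \<in> iso G G" "x \<in> carrier G"
  shows "\<exists>\<psi>\<in>iso G G. \<psi> (\<phi> x) = x"
proof (intro bexI)
  show "inv_into (carrier G) \<phi> \<in> iso G G"
    using assms(1) by (rule iso_set_sym)
  show "inv_into (carrier G) \<phi> (\<phi> x) = x"
    using assms by (simp add: iso_def bij_betw_def)
qed

definition aut_orbit :: "'a \<Rightarrow> 'a \<Rightarrow> bool" where
  "aut_orbit x y \<longleftrightarrow> (\<exists>\<phi>\<in>iso G G. \<phi> x = y)"

lemma aut_orbit_refl: "aut_orbit x x"
  unfolding aut_orbit_def using iso_set_refl[of G] by (intro bexI[of _ "\<lambda>x. x"]) simp_all

lemma aut_orbit_sym: "\<lbrakk>aut_orbit x y; x \<in> carrier G\<rbrakk> \<Longrightarrow> aut_orbit y x"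
  unfolding aut_orbit_def using iso_self_inverse by blast

lemma aut_orbit_trans: "\<lbrakk>aut_orbit x y; aut_orbit y w\<rbrakk> \<Longrightarrow> aut_orbit x w"
  unfolding aut_orbit_def using iso_set_trans by (metis comp_apply)

lemma iso_self_closed: "\<lbrakk>\<phi> \<in> iso G G; x \<in> carrier G\<rbrakk> \<Longrightarrow> \<phi> x \<in> carrier G"
  by (auto simp: iso_def hom_def)

lemma iso_self_mult:
  "\<lbrakk>\<phi> \<in> iso G G; x \<in> carrier G; y \<in> carrier G\<rbrakk> \<Longrightarrow> \<phi> (x \<otimes> y) = \<phi> x \<otimes> \<phi> y"
  by (auto simp: iso_def hom_def)

lemma iso_self_one: "\<phi> \<in> iso G G \<Longrightarrow> \<phi> \<one> = \<one>"
  using hom_one iso_def by (metis (mono_tags) is_group mem_Collect_eq)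

lemma iso_self_inv: "\<lbrakk>\<phi> \<in> iso G G; x \<in> carrier G\<rbrakk> \<Longrightarrow> \<phi> (inv x) = inv (\<phi> x)"
  by (metis inv_comm inv_equality iso_self_closed iso_self_mult iso_self_one inv_closed l_inv)

lemma iso_self_pow: "\<lbrakk>\<phi> \<in> iso G G; x \<in> carrier G\<rbrakk> \<Longrightarrow> \<phi> (x [^] (n::nat)) = \<phi> x [^] n"
  by (induction n) (simp_all add: iso_self_one iso_self_mult)

lemma iso_self_eq_iff:
  "\<lbrakk>\<phi> \<in> iso G G; x \<in> carrier G; y \<in> carrier G\<rbrakk> \<Longrightarrow> \<phi> x = \<phi> y \<longleftrightarrow> x = y"
  by (auto simp: iso_def bij_betw_def inj_on_def)

lemma iso_self_image: "\<phi> \<in> iso G G \<Longrightarrow> \<phi> ` carrier G = carrier G"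
  by (auto simp: iso_def bij_betw_def)

lemma conj_aut:
  assumes "u \<in> carrier G" "finite (carrier G)"
  shows "(\<lambda>x. u \<otimes> x \<otimes> inv u) \<in> iso G G"
proof (rule iso_self_if_trivial_kernel)
  show "(\<lambda>x. u \<otimes> x \<otimes> inv u) \<in> hom G G"
    using assms by (auto simp: hom_def m_assoc)
  fix x assume x: "x \<in> carrier G" "u \<otimes> x \<otimes> inv u = \<one>"
  have "x = inv u \<otimes> (u \<otimes> x \<otimes> inv u) \<otimes> u"
    using assms x(1) by (simp add: m_assoc)
  then show "x = \<one>" using assms x by simp
qed (use assms in simp)

lemma subgroup_pow_closed: "\<lbrakk>subgroup H G; x \<in> H\<rbrakk> \<Longrightarrow> x [^] (n::nat) \<in> H"
  by (induction n) (auto simp: subgroup.one_closed subgroup.m_closed)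

text \<open>If neither inclusion held, the product of an element outside \<open>A\<close> and one
  outside \<open>B\<close> would lie in \<open>A\<close> or \<open>B\<close>, and cancelling the
  factor lying there would put the other one where it is excluded.\<close>

lemma union_two_subgroups:
  assumes "subgroup H G" "subgroup A G" "subgroup B G" "H \<subseteq> A \<union> B"
  shows "H \<subseteq> A \<or> H \<subseteq> B"
proof (rule ccontr)
  assume "\<not> ?thesis"
  then obtain a b where ab: "a \<in> H" "a \<notin> A" "b \<in> H" "b \<notin> B" by blast
  then have "a \<otimes> b \<in> H"
    using assms(1) by (simp add: subgroup.m_closed)
  then have "a \<in> B" "b \<in> A" "a \<otimes> b \<in> A \<union> B" and c: "a \<in> carrier G" "b \<in> carrier G"
    using assms ab by (auto simp: subgroup.mem_carrier)
  then consider "a \<otimes> b \<in> A" | "a \<otimes> b \<in> B" by blast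
  then show False
  proof cases
    case 1
    then have "(a \<otimes> b) \<otimes> inv b \<in> A"
      using assms \<open>b \<in> A\<close> by (simp add: subgroup.m_closed subgroup.m_inv_closed)
    then show ?thesis using ab c by (simp add: m_assoc)
  next
    case 2
    then have "inv a \<otimes> (a \<otimes> b) \<in> B"
      using assms \<open>a \<in> B\<close> by (simp add: subgroup.m_closed subgroup.m_inv_closed)
    then show ?thesis using ab c by simp
  qed
qed

text \<open>The bracketing matches the generators in \<open>derived_set\<close>, so commutators fall
  into the derived subgroup by definition.\<close>

definition cmt :: "'a \<Rightarrow> 'a \<Rightarrow> 'a" where
  "cmt x y = x \<otimes> y \<otimes> inv x \<otimes> inv y"

lemma cmt_closed [simp, intro]: "\<lbrakk>x \<in> carrier G; y \<in> carrier G\<rbrakk> \<Longrightarrow> cmt x y \<in> carrier G"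
  by (simp add: cmt_def)

lemma cmt_mult: "\<lbrakk>x \<in> carrier G; y \<in> carrier G\<rbrakk> \<Longrightarrow> x \<otimes> y = cmt x y \<otimes> (y \<otimes> x)"
  by (simp add: cmt_def m_assoc)

lemma cmt_eq_one_iff: "\<lbrakk>x \<in> carrier G; y \<in> carrier G\<rbrakk> \<Longrightarrow> cmt x y = \<one> \<longleftrightarrow> x \<otimes> y = y \<otimes> x"
  by (metis cmt_closed cmt_mult l_one m_closed r_cancel_one')

lemma cmt_self [simp]: "x \<in> carrier G \<Longrightarrow> cmt x x = \<one>"
  by (simp add: cmt_eq_one_iff)

lemma cmt_inv: "\<lbrakk>x \<in> carrier G; y \<in> carrier G\<rbrakk> \<Longrightarrow> inv (cmt x y) = cmt y x"
  by (simp add: cmt_def inv_mult_group m_assoc)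

lemma cmt_eq_one_commute: "\<lbrakk>x \<in> carrier G; y \<in> carrier G\<rbrakk> \<Longrightarrow> cmt x y = \<one> \<longleftrightarrow> cmt y x = \<one>"
  by (auto simp: cmt_eq_one_iff)

lemma iso_self_cmt:
  "\<lbrakk>\<phi> \<in> iso G G; x \<in> carrier G; y \<in> carrier G\<rbrakk> \<Longrightarrow> \<phi> (cmt x y) = cmt (\<phi> x) (\<phi> y)"
  by (simp add: cmt_def iso_self_mult iso_self_inv iso_self_closed)

lemma mem_group_center_iff: "z \<in> group_center G \<longleftrightarrow> z \<in> carrier G \<and> (\<forall>g\<in>carrier G. cmt g z = \<one>)"
  unfolding group_center_def by (auto simp: cmt_eq_one_iff)

lemma iso_self_center:
  assumes "\<phi> \<in> iso G G" "x \<in> carrier G"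
  shows "\<phi> x \<in> group_center G \<longleftrightarrow> x \<in> group_center G"
proof -
  have "(\<forall>g\<in>carrier G. cmt g (\<phi> x) = \<one>) \<longleftrightarrow> (\<forall>g\<in>carrier G. cmt (\<phi> g) (\<phi> x) = \<one>)"
    using iso_self_image[OF assms(1)] by (metis imageE imageI)
  also have "\<dots> \<longleftrightarrow> (\<forall>g\<in>carrier G. cmt g x = \<one>)"
    using assms iso_self_eq_iff[OF assms(1) _ one_closed] by (simp add: iso_self_cmt[symmetric] iso_self_one)
  finally show ?thesis
    using assms iso_self_closed by (simp add: mem_group_center_iff)
qed

end

section \<open>Central commutators: bilinearity and power formulas\<close>

locale extraspecial = group G for G (structure) +
  fixes p :: nat
  assumes prime_p: "Factorial_Ring.prime p" and extraspecial: "extraspecial_p_group p G"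
begin

abbreviation Z :: "'a set" where "Z \<equiv> group_center G"

lemma fin [simp]: "finite (carrier G)"
  using extraspecial by (auto simp: extraspecial_p_group_def special_p_group_def p_group_def)

lemma order_prime_power: "\<exists>n. card (carrier G) = p ^ n"
  using extraspecial by (auto simp: extraspecial_p_group_def special_p_group_def p_group_def)

lemma card_Z: "card Z = p"
  using extraspecial by (simp add: extraspecial_p_group_def)

lemma p_gt_1: "1 < p"
  using prime_p prime_gt_1_nat by blast

lemma subgroup_Z: "subgroup Z G"
  and Z_eq_derived: "Z = derived G (carrier G)"
  and Z_pow_p [simp]: "z \<in> Z \<Longrightarrow> z [^] p = \<one>"
  using extraspecial
  unfolding extraspecial_p_group_def special_p_group_def elementary_abelian_def by blast+

lemma Z_closed [simp]: "z \<in> Z \<Longrightarrow> z \<in> carrier G"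
  by (simp add: mem_group_center_iff)

lemma one_in_Z [simp]: "\<one> \<in> Z"
  and Z_mult [simp]: "\<lbrakk>x \<in> Z; y \<in> Z\<rbrakk> \<Longrightarrow> x \<otimes> y \<in> Z"
  and Z_inv [simp]: "x \<in> Z \<Longrightarrow> inv x \<in> Z"
  and Z_pow [simp]: "x \<in> Z \<Longrightarrow> x [^] (n::nat) \<in> Z"
  using subgroup_Z
  by (simp_all add: subgroup.one_closed subgroup.m_closed subgroup.m_inv_closed subgroup_pow_closed)



lemma Z_commute: "\<lbrakk>z \<in> Z; g \<in> carrier G\<rbrakk> \<Longrightarrow> z \<otimes> g = g \<otimes> z"
  unfolding group_center_def by blast

lemma cmt_Z [simp]: "\<lbrakk>z \<in> Z; g \<in> carrier G\<rbrakk> \<Longrightarrow> cmt z g = \<one>" "\<lbrakk>z \<in> Z; g \<in> carrier G\<rbrakk> \<Longrightarrow> cmt g z = \<one>"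
  using Z_commute by (auto simp only: cmt_eq_one_iff Z_closed)

lemma cmt_in_Z [simp]:
  assumes "x \<in> carrier G" "y \<in> carrier G"
  shows "cmt x y \<in> Z"
proof -
  have "cmt x y \<in> derived_set G (carrier G)"
    using assms by (auto simp: cmt_def)
  then have "cmt x y \<in> derived G (carrier G)"
    unfolding derived_def by (rule generate.incl)
  then show ?thesis
    by (simp add: Z_eq_derived)
qed

lemma Z_neq_carrier: "Z \<noteq> carrier G"
proof
  assume eq: "Z = carrier G"
  have "derived_set G (carrier G) \<subseteq> {\<one>}"
    using eq by (auto simp: cmt_def[symmetric])
  then have "derived G (carrier G) \<subseteq> {\<one>}"
    unfolding derived_def using generate_subgroup_incl triv_subgroup by blast
  then have "Z \<subseteq> {\<one>}"
    by (simp add: Z_eq_derived)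
  then have "card Z \<le> 1"
    using card_mono[of "{\<one>}" Z] by simp
  then show False using card_Z p_gt_1 by simp
qed

text \<open>The general expansion of \<open>[xy, g]\<close> contains the conjugate of
  \<open>[y, g]\<close> by \<open>x\<close>, which centrality replaces by \<open>[y, g]\<close>
  itself.\<close>

lemma cmt_mult_left:
  assumes [simp]: "x \<in> carrier G" "y \<in> carrier G" "g \<in> carrier G"
  shows "cmt (x \<otimes> y) g = cmt x g \<otimes> cmt y g"
proof -
  have "cmt (x \<otimes> y) g = x \<otimes> (y \<otimes> g \<otimes> inv y \<otimes> inv g) \<otimes> (g \<otimes> inv x \<otimes> inv g)"
    by (simp add: cmt_def inv_mult_group m_assoc)
  also have "\<dots> = cmt y g \<otimes> x \<otimes> (g \<otimes> inv x \<otimes> inv g)"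
    using Z_commute[of "cmt y g" x] by (simp add: cmt_def[symmetric])
  also have "\<dots> = cmt y g \<otimes> cmt x g"
    by (simp add: cmt_def m_assoc)
  finally show ?thesis by (simp add: Z_commute)
qed

lemma cmt_mult_right:
  assumes [simp]: "x \<in> carrier G" "y \<in> carrier G" "g \<in> carrier G"
  shows "cmt g (x \<otimes> y) = cmt g x \<otimes> cmt g y"
proof -
  have "cmt g (x \<otimes> y) = inv (cmt x g \<otimes> cmt y g)"
    by (simp add: cmt_inv[symmetric, of "x \<otimes> y" g] cmt_mult_left)
  then show ?thesis by (simp add: inv_mult_group cmt_inv Z_commute)
qed

lemma cmt_pow_left:
  "\<lbrakk>x \<in> carrier G; g \<in> carrier G\<rbrakk> \<Longrightarrow> cmt (x [^] (n::nat)) g = cmt x g [^] n"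
  by (induction n) (simp_all add: cmt_mult_left)

lemma cmt_pow_right:
  "\<lbrakk>x \<in> carrier G; g \<in> carrier G\<rbrakk> \<Longrightarrow> cmt g (x [^] (n::nat)) = cmt g x [^] n"
  by (induction n) (simp_all add: cmt_mult_right)

lemma cmt_inv_left:
  assumes "x \<in> carrier G" "g \<in> carrier G"
  shows "cmt (inv x) g = cmt g x"
proof -
  have "cmt x g \<otimes> cmt (inv x) g = \<one>"
    using assms by (simp add: cmt_mult_left[symmetric])
  then have "inv (cmt x g) = cmt (inv x) g"
    using assms by (metis Z_commute cmt_in_Z cmt_closed inv_closed inv_equality)
  then show ?thesis using assms by (simp add: cmt_inv)
qed

lemma cmt_inv_right:
  assumes "x \<in> carrier G" "g \<in> carrier G"
  shows "cmt g (inv x) = cmt x g"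
  using assms cmt_inv[of "inv x" g] by (simp add: cmt_inv_left cmt_inv)

text \<open>\<open>[g, x^p] = [g, x]^p\<close>, and \<open>Z\<close> has exponent
  \<open>p\<close>.\<close>

lemma pow_p_in_Z [simp]: "x \<in> carrier G \<Longrightarrow> x [^] p \<in> Z"
  unfolding mem_group_center_iff by (simp add: cmt_pow_right)

lemma ord_Z:
  assumes "z \<in> Z" "z \<noteq> \<one>" shows "ord z = p"
proof -
  have "ord z dvd p" using assms pow_eq_id[of z p] by simp
  moreover have "ord z \<noteq> 1" using assms ord_eq_1[of z] by simp
  ultimately show ?thesis using prime_p unfolding prime_nat_iff by blast
qed

lemma Z_pow_eq_one_iff:
  "\<lbrakk>z \<in> Z; z \<noteq> \<one>\<rbrakk> \<Longrightarrow> z [^] (n::nat) = \<one> \<longleftrightarrow> p dvd n"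
  by (simp add: pow_eq_id ord_Z)

text \<open>\<open>Z\<close> has prime order, so the \<open>p\<close> distinct powers of a
  nontrivial element exhaust it. The exponents play the part of scalars in the prime field.\<close>

lemma Z_powers:
  assumes "z \<in> Z" "z \<noteq> \<one>" "s \<in> Z"
  shows "\<exists>n<p. s = z [^] (n::nat)"
proof -
  have inj: "inj_on (\<lambda>n. z [^] n) {..<p}"
  proof -
    have "{..<p} = {0..ord z - 1}"
      using assms(1,2) p_gt_1 by (auto simp: ord_Z)
    then show ?thesis using ord_inj[of z] assms(1) by simp
  qed
  have "(\<lambda>n. z [^] n) ` {..<p} = Z"
    using card_image[OF inj] card_Z assms by (intro card_subset_eq) (auto intro: finite_subset[OF _ fin])
  then show ?thesis using assms(3) by auto
qed

lemma noncentral_cmt: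
  assumes "x \<in> carrier G" "x \<notin> Z"
  shows "\<exists>u\<in>carrier G. cmt x u \<noteq> \<one>"
  using assms cmt_eq_one_commute unfolding mem_group_center_iff by blast

text \<open>Collection in class 2: sorting the factors moves each \<open>y\<close> past all later
  \<open>x\<close>, which makes \<open>n(n-1)/2\<close> swaps.\<close>

lemma pow_mult_cmt:
  assumes [simp]: "x \<in> carrier G" "y \<in> carrier G"
  shows "(x \<otimes> y) [^] (n::nat) = x [^] n \<otimes> y [^] n \<otimes> cmt y x [^] (n * (n - 1) div 2)"
proof (induction n)
  case (Suc n)
  have e: "n * (n - 1) div 2 + n = Suc n * (Suc n - 1) div 2"
    by (cases n) (simp_all add: algebra_simps)
  define c where "c = cmt y x"
  have c: "c \<in> Z" by (simp add: c_def)
  have "(x \<otimes> y) [^] Suc n = x [^] n \<otimes> y [^] n \<otimes> c [^] (n * (n - 1) div 2) \<otimes> (x \<otimes> y)"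
    using Suc by (simp add: c_def)
  also have "\<dots> = x [^] n \<otimes> (y [^] n \<otimes> x) \<otimes> y \<otimes> c [^] (n * (n - 1) div 2)"
    using c Z_commute[of "c [^] (n * (n - 1) div 2)" "x \<otimes> y"] by (simp add: m_assoc)
  also have "y [^] n \<otimes> x = c [^] n \<otimes> (x \<otimes> y [^] n)"
    using cmt_mult[of "y [^] n" x] by (simp add: cmt_pow_left c_def)
  also have "x [^] n \<otimes> (c [^] n \<otimes> (x \<otimes> y [^] n)) \<otimes> y \<otimes> c [^] (n * (n - 1) div 2)
      = x [^] Suc n \<otimes> y [^] Suc n \<otimes> (c [^] (n * (n - 1) div 2) \<otimes> c [^] n)"
    using c Z_commute[of "c [^] n" "x \<otimes> y [^] n \<otimes> y \<otimes> c [^] (n * (n - 1) div 2)"] by (simp add: m_assoc)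
  finally show ?case using c by (simp only: nat_pow_mult Z_closed e c_def[symmetric])
qed simp

lemma pow_mult_commuting:
  "\<lbrakk>x \<in> carrier G; y \<in> carrier G; cmt x y = \<one>\<rbrakk> \<Longrightarrow> (x \<otimes> y) [^] (n::nat) = x [^] n \<otimes> y [^] n"
  using pow_mult_cmt[of x y n] cmt_eq_one_commute[of x y] by simp

text \<open>For odd \<open>p\<close> the number \<open>p(p-1)/2\<close> of swaps is a multiple of
  \<open>p\<close>. For \<open>p = 2\<close> the commutator survives and squaring is a quadratic
  form instead.\<close>

lemma pow_p_mult_odd:
  assumes "odd p" "x \<in> carrier G" "y \<in> carrier G"
  shows "(x \<otimes> y) [^] p = x [^] p \<otimes> y [^] p"
proof -
  have "p dvd p * (p - 1) div 2"
  proof -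
    obtain k where k: "p = 2 * k + 1" using assms(1) by (rule oddE)
    then have "p * (p - 1) div 2 = p * k" by simp
    then show ?thesis by simp
  qed
  then obtain k where "p * (p - 1) div 2 = p * k" by blast
  then have "cmt y x [^] (p * (p - 1) div 2) = \<one>"
    using assms by (simp add: nat_pow_pow[of "cmt y x" p k, symmetric])
  then show ?thesis using assms by (simp add: pow_mult_cmt)
qed

end

section \<open>Automorphisms moving one element to another\<close>

context extraspecial
begin

lemma subgroup_commutant:
  assumes "a \<in> carrier G"
  shows "subgroup {g \<in> carrier G. cmt g a = \<one>} G"
  using assms by (intro subgroupI) (auto simp: cmt_mult_left cmt_inv_left cmt_eq_one_commute[of a])

text \<open>Every \<open>g\<close> equals \<open>x\<^sup>i c\<close> with \<open>c\<close> commuting with \<open>a = x\<inverse> y\<close>; the automorphism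
  sends \<open>x\<^sup>i c\<close> to \<open>y\<^sup>i c\<close>. It lifts a transvection (symplectic or orthogonal) of \<open>G/Z\<close>.\<close>

lemma aut_orbit_noncommuting:
  assumes x [simp]: "x \<in> carrier G" and y [simp]: "y \<in> carrier G"
    and xy: "cmt x y \<noteq> \<one>" and pow: "x [^] p = y [^] p"
  shows "aut_orbit x y"
proof -
  define a where "a = inv x \<otimes> y"
  have a [simp]: "a \<in> carrier G" by (simp add: a_def)
  define z where "z = cmt x a"
  have z_xy: "z = cmt x y" by (simp add: z_def a_def cmt_mult_right cmt_inv_right)
  have z: "z \<in> Z" "z \<noteq> \<one>" using xy by (simp_all add: z_xy)
  \<comment> \<open>\<open>\<tau> i\<close> is the left factor that turns \<open>x^i c\<close> into
    \<open>y^i c\<close>.\<close>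
  define \<tau> where "\<tau> i = y [^] i \<otimes> inv (x [^] i)" for i :: nat
  have \<tau> [simp]: "\<tau> i \<in> carrier G" for i by (simp add: \<tau>_def)
  \<comment> \<open>Equality of the \<open>p\<close>-th powers makes \<open>\<tau>\<close> periodic
    with period \<open>p\<close>, so it depends on \<open>z^i\<close> alone.\<close>
  have \<tau>_shift: "\<tau> (i + p * k) = \<tau> i" for i k
  proof -
    have "y [^] (i + p * k) = y [^] i \<otimes> (y [^] p) [^] k"
      by (simp add: nat_pow_mult nat_pow_pow)
    moreover have "x [^] (i + p * k) = x [^] i \<otimes> (y [^] p) [^] k"
      by (simp add: nat_pow_mult nat_pow_pow pow [symmetric])
    ultimately show ?thesis by (simp add: \<tau>_def inv_mult_group m_assoc)
  qed
  have \<tau>_cong: "\<tau> i = \<tau> j" if "z [^] i = z [^] j" for i j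
  proof -
    have *: "\<tau> i = \<tau> j" if "z [^] i = z [^] j" "i \<le> j" for i j
    proof -
      have "z [^] i \<otimes> z [^] (j - i) = z [^] (i + (j - i))"
        using z by (simp only: nat_pow_mult Z_closed)
      then have "z [^] i \<otimes> z [^] (j - i) = z [^] i \<otimes> \<one>"
        using that z by simp
      then have "z [^] (j - i) = \<one>"
        using z by (simp only: l_cancel nat_pow_closed one_closed Z_closed)
      then obtain k where "j - i = p * k"
        using z by (auto simp: Z_pow_eq_one_iff)
      then have "j = i + p * k" using that by simp
      then show ?thesis by (simp add: \<tau>_shift)
    qed
    show ?thesis using *[OF that] *[OF that[symmetric]] nat_le_linear[of i j] by argo
  qed
  \<comment> \<open>Any exponent will do, by \<open>\<tau>_cong\<close>; hence the arbitrary
    choice.\<close>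
  define e where "e g = (SOME i::nat. cmt g a = z [^] i)" for g
  have e: "cmt g a = z [^] e g" if "g \<in> carrier G" for g
    unfolding e_def using Z_powers[OF z, of "cmt g a"] that by (intro someI_ex[of "\<lambda>i. cmt g a = z [^] i"]) auto
  have \<tau>_e: "\<tau> (e g) = \<tau> i" if "g \<in> carrier G" "cmt g a = z [^] i" for g i
    using that by (intro \<tau>_cong) (simp add: e)
  have ya: "cmt y a = z"
  proof -
    have "x \<otimes> a = y" by (simp add: a_def)
    then show ?thesis using cmt_mult_left[of x a a] by (simp add: z_def)
  qed
  define \<phi> where "\<phi> g = \<tau> (e g) \<otimes> g" for g
  have "\<phi> \<in> hom G G"
  proof (rule homI)
    fix g h assume [simp]: "g \<in> carrier G" "h \<in> carrier G"
    define i j where "i = e g" and "j = e h"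
    define c where "c = inv (x [^] i) \<otimes> g"
    have [simp]: "c \<in> carrier G" by (simp add: c_def)
    have ca: "cmt c a = \<one>"
    proof -
      have "cmt c a = inv (z [^] i) \<otimes> z [^] i"
        using z e[of g] by (simp add: c_def i_def cmt_mult_left cmt_inv_left cmt_pow_left z_def
            cmt_inv[symmetric, of "x [^] e g" a])
      then show ?thesis using z by simp
    qed
    \<comment> \<open>As \<open>y = x a\<close> and \<open>c\<close> commutes with \<open>a\<close>,
      the contributions of \<open>y^j\<close> and of the inverse of \<open>x^j\<close> to
      \<open>[c, \<tau> j]\<close> cancel.\<close>
    have "cmt c y = cmt c x"
      using cmt_mult_right[of x a c] ca by (simp add: a_def)
    then have "cmt c (\<tau> j) = \<one>"
      using z by (simp add: \<tau>_def cmt_mult_right cmt_pow_right cmt_inv_right cmt_pow_left cmt_inv[symmetric, of c x]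
         nat_pow_inv)
    then have comm: "c \<otimes> \<tau> j = \<tau> j \<otimes> c" by (simp add: cmt_eq_one_iff)
    have g: "g = x [^] i \<otimes> c" by (simp add: c_def)
    have "\<phi> (g \<otimes> h) = \<tau> (j + i) \<otimes> (g \<otimes> h)"
    proof -
      have "cmt (g \<otimes> h) a = z [^] (j + i)"
        using z e[of g] e[of h] by (simp add: cmt_mult_left i_def j_def nat_pow_mult add.commute)
      then show ?thesis by (simp add: \<phi>_def \<tau>_e)
    qed
    also have "\<dots> = y [^] i \<otimes> (\<tau> j \<otimes> c) \<otimes> h"
      by (simp add: \<tau>_def g m_assoc inv_mult_group flip: nat_pow_mult add: add.commute[of j i])
    also have "\<dots> = (\<tau> i \<otimes> g) \<otimes> (\<tau> j \<otimes> h)"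
      unfolding comm[symmetric] by (simp add: g \<tau>_def[of i] m_assoc)
    finally show "\<phi> (g \<otimes> h) = \<phi> g \<otimes> \<phi> h" by (simp add: \<phi>_def i_def j_def)
  qed (simp add: \<phi>_def)
  moreover have "g = \<one>" if g [simp]: "g \<in> carrier G" and "\<phi> g = \<one>" for g
  proof -
    \<comment> \<open>\<open>[x, a] = [y, a] = z\<close>, so \<open>\<tau>\<close> commutes with
      \<open>a\<close> and \<open>\<phi>\<close> preserves the commutator with \<open>a\<close>. On
      the kernel that commutator is 1, and \<open>\<phi>\<close> is the identity there.\<close>
    have "cmt (\<tau> (e g)) a = \<one>"
      using z by (simp add: \<tau>_def cmt_mult_left cmt_pow_left cmt_inv_left ya
         cmt_inv[symmetric, of "x [^] e g" a] z_def[symmetric])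
    then have "cmt (\<phi> g) a = cmt g a"
      by (simp add: \<phi>_def cmt_mult_left)
    then have "cmt g a = z [^] (0::nat)" using that by simp
    then have "\<tau> (e g) = \<tau> 0" using g by (intro \<tau>_e)
    then show ?thesis using that by (simp add: \<phi>_def \<tau>_def)
  qed
  ultimately have "\<phi> \<in> iso G G" by (intro iso_self_if_trivial_kernel) auto
  moreover have "\<tau> (e x) = \<tau> 1"
    using z by (intro \<tau>_e) (simp_all add: z_def)
  then have "\<phi> x = y" by (simp add: \<phi>_def \<tau>_def m_assoc)
  ultimately show ?thesis unfolding aut_orbit_def by blast
qed

text \<open>Inner automorphisms suffice: conjugation by \<open>u^n\<close> multiplies
  \<open>x\<close> by \<open>[u, x]^n\<close>, and a nontrivial \<open>[u, x]\<close> generates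
  \<open>Z\<close>.\<close>

lemma aut_orbit_coset:
  assumes [simp]: "x \<in> carrier G" and "x \<notin> Z" and s: "s \<in> Z"
  shows "aut_orbit x (s \<otimes> x)"
proof -
  obtain u where u [simp]: "u \<in> carrier G" "cmt u x \<noteq> \<one>"
    using noncentral_cmt assms cmt_eq_one_commute by metis
  then obtain n :: nat where n: "s = cmt u x [^] n"
    using Z_powers[of "cmt u x" s] s by auto
  then have "s = cmt (u [^] n) x" by (simp add: cmt_pow_left)
  then have "u [^] n \<otimes> x \<otimes> inv (u [^] n) = s \<otimes> x"
    by (simp add: cmt_def m_assoc)
  then show ?thesis
    unfolding aut_orbit_def using conj_aut[of "u [^] n"] by (auto intro!: bexI)
qed

lemma aut_orbit_via:
  assumes "x \<in> carrier G" "y \<in> carrier G" "w \<in> carrier G"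
    and "cmt x w \<noteq> \<one>" "cmt y w \<noteq> \<one>" "x [^] p = w [^] p" "y [^] p = w [^] p"
  shows "aut_orbit x y"
  using assms aut_orbit_noncommuting[of x w] aut_orbit_noncommuting[of y w]
    aut_orbit_sym aut_orbit_trans by metis

text \<open>Otherwise \<open>H\<close> would be covered by the centralisers of \<open>x\<close> and
  \<open>y\<close>, hence lie in one of them, against \<open>u\<close> or \<open>v\<close>. A
  general \<open>H\<close> allows \<open>w\<close> to be sought among elements with prescribed
  \<open>p\<close>-th power.\<close>

lemma ex_noncommuting_both:
  assumes "subgroup H G" "x \<in> carrier G" "y \<in> carrier G"
    and "u \<in> H" "cmt x u \<noteq> \<one>" "v \<in> H" "cmt y v \<noteq> \<one>"
  shows "\<exists>w\<in>H. cmt x w \<noteq> \<one> \<and> cmt y w \<noteq> \<one>"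
proof -
  have H: "H \<subseteq> carrier G" using assms(1) by (rule subgroup.subset)
  have "\<not> H \<subseteq> {g \<in> carrier G. cmt g x = \<one>} \<union> {g \<in> carrier G. cmt g y = \<one>}"
    using union_two_subgroups[OF assms(1) subgroup_commutant subgroup_commutant, of x y] assms
    by (smt (verit) H cmt_eq_one_commute mem_Collect_eq subset_iff)
  then show ?thesis using H assms(2,3) cmt_eq_one_commute by blast
qed

text \<open>A lift of a Siegel transformation of the quadratic space \<open>G/Z\<close> over the field with two elements.
  It is needed because orthogonal transvections do not act transitively on the
  elements of order 4 of the extraspecial group of order 32 and plus type.\<close>

lemma aut_orbit_siegel:
  assumes p: "p = 2" and [simp]: "x \<in> carrier G" "y \<in> carrier G" "u \<in> carrier G"
    and xy: "cmt x y = \<one>" "x [^] p = y [^] p"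
    and u: "u [^] p = \<one>" "cmt x u \<noteq> \<one>" "cmt y u \<noteq> \<one>"
  shows "aut_orbit x y"
proof -
  \<comment> \<open>The displacement from \<open>x\<close> to \<open>y\<close>. It squares to 1 and
    commutes with \<open>u\<close>, so \<open>t\<close> and \<open>u\<close> span a totally singular
    subspace of \<open>G/Z\<close>.\<close>
  define t where "t = inv x \<otimes> y"
  have t [simp]: "t \<in> carrier G" by (simp add: t_def)
  define z where "z = cmt x u"
  have z: "z \<in> Z" "z \<noteq> \<one>" using u by (simp_all add: z_def)
  have [simp]: "z \<in> carrier G" using z by simp
  have two: "c = \<one> \<or> c = z" if "c \<in> Z" for c
    using Z_powers[OF z that] p by (auto simp: less_2_cases_iff)
  have zz: "z \<otimes> z = \<one>" using Z_pow_p[OF z(1)] by (simp add: p numeral_2_eq_2)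
  have uu: "u \<otimes> u = \<one>" using u(1) by (simp add: p numeral_2_eq_2)
  have yu: "cmt y u = z" using two[of "cmt y u"] u by simp
  have tt: "t \<otimes> t = \<one>"
  proof -
    have "cmt (inv x) y = \<one>" using xy(1) cmt_eq_one_commute[of x y] by (simp add: cmt_inv_left)
    then have "t [^] p = inv x [^] p \<otimes> y [^] p"
      unfolding t_def by (intro pow_mult_commuting) auto
    also have "\<dots> = \<one>" using xy(2) by (simp add: nat_pow_inv)
    finally show ?thesis by (simp add: p numeral_2_eq_2)
  qed
  have tu: "cmt t u = \<one>"
    using yu zz by (simp add: t_def cmt_mult_left cmt_inv_left cmt_inv[symmetric, of x u] z_def[symmetric])
  have xt: "cmt x t = \<one>"
    using xy(1) by (simp add: t_def cmt_mult_right cmt_inv_right)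
  define \<epsilon> where "\<epsilon> g = (if cmt g t = \<one> then 0 else 1 :: nat)" for g
  define \<delta> where "\<delta> g = (if cmt g u = \<one> then 0 else 1 :: nat)" for g
  have \<epsilon>: "cmt g t = z [^] \<epsilon> g" if "g \<in> carrier G" for g
    using two[of "cmt g t"] that by (auto simp: \<epsilon>_def)
  have \<delta>: "cmt g u = z [^] \<delta> g" if "g \<in> carrier G" for g
    using two[of "cmt g u"] that by (auto simp: \<delta>_def)
  \<comment> \<open>Modulo \<open>Z\<close>, multiplying by this adds
    \<open>(g,t) u + (g,u) t\<close> to \<open>g\<close>. The factor \<open>z^(ef)\<close> makes the
    map multiplicative: the cross terms of \<open>(e+e')(f+f')\<close> are exactly the commutators
    created when \<open>h\<close> passes \<open>u^e t^f\<close>.\<close>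
  define \<tau> where "\<tau> e f = u [^] e \<otimes> t [^] f \<otimes> z [^] (e * f)" for e f :: nat
  have \<tau> [simp]: "\<tau> e f \<in> carrier G" for e f by (simp add: \<tau>_def)
  define \<phi> where "\<phi> g = g \<otimes> \<tau> (\<epsilon> g) (\<delta> g)" for g
  have par: "a [^] (n::nat) = a [^] (n mod 2)" if "a \<otimes> a = \<one>" "a \<in> carrier G" for a n
  proof -
    have "a [^] (2 * (n div 2) + n mod 2) = (a [^] (2::nat)) [^] (n div 2) \<otimes> a [^] (n mod 2)"
      using that(2) by (simp only: nat_pow_mult nat_pow_pow)
    moreover have "a [^] (2::nat) = \<one>" using that by (simp add: numeral_2_eq_2)
    ultimately show ?thesis using that(2) by simp
  qed
  \<comment> \<open>Only parities may matter, because \<open>\<epsilon>\<close> and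
    \<open>\<delta>\<close> are additive only modulo 2; this holds as \<open>u\<close>,
    \<open>t\<close> and \<open>z\<close> square to 1.\<close>
  have \<tau>_mod: "\<tau> e f = \<tau> (e mod 2) (f mod 2)" for e f
    unfolding \<tau>_def using par[OF uu, of e] par[OF tt, of f] par[OF zz, of "e * f"]
      par[OF zz, of "(e mod 2) * (f mod 2)"] by (simp add: mod_mult_eq)
  have mod_cong: "e mod 2 = f mod 2" if "z [^] e = z [^] f" for e f :: nat
  proof (rule ccontr)
    assume "e mod 2 \<noteq> f mod 2"
    then have "{e mod 2, f mod 2} = {0, 1}" by auto
    then show False
      using that z(2) par[OF zz, of e] par[OF zz, of f] by (auto simp: doubleton_eq_iff)
  qed
  have "\<phi> \<in> hom G G"
  proof (rule homI)
    fix g h assume [simp]: "g \<in> carrier G" "h \<in> carrier G"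
    define e f e' f' where "e = \<epsilon> g" and "f = \<delta> g" and "e' = \<epsilon> h" and "f' = \<delta> h"
    have ht: "t [^] f \<otimes> h = z [^] (e' * f) \<otimes> (h \<otimes> t [^] f)"
    proof -
      have "cmt t h = cmt h t"
        using two[of "cmt h t"] zz cmt_inv[of h t] inv_equality[of z z] by auto
      then have "cmt (t [^] f) h = z [^] (e' * f)"
        using \<epsilon>[of h] by (simp add: cmt_pow_left e'_def nat_pow_pow)
      then show ?thesis using cmt_mult[of "t [^] f" h] by simp
    qed
    have hu: "u [^] e \<otimes> h = z [^] (f' * e) \<otimes> (h \<otimes> u [^] e)"
    proof -
      have "cmt u h = cmt h u"
        using two[of "cmt h u"] zz cmt_inv[of h u] inv_equality[of z z] by auto
      then have "cmt (u [^] e) h = z [^] (f' * e)"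
        using \<delta>[of h] by (simp add: cmt_pow_left f'_def nat_pow_pow)
      then show ?thesis using cmt_mult[of "u [^] e" h] by simp
    qed
    have tu': "t [^] f \<otimes> u [^] e' = u [^] e' \<otimes> t [^] f"
      using tu by (simp add: cmt_eq_one_iff[symmetric] cmt_pow_left cmt_pow_right)
    have zc: "a \<otimes> (z [^] n \<otimes> b) = z [^] n \<otimes> (a \<otimes> b)" if "a \<in> carrier G" "b \<in> carrier G" for a b and n :: nat
      using that Z_commute[of "z [^] n" a] z(1) by (simp add: m_assoc[symmetric])
    have zc1: "a \<otimes> z [^] n = z [^] n \<otimes> a" if "a \<in> carrier G" for a and n :: nat
      using that Z_commute[of "z [^] n" a] z(1) by simp
    have zz1: "z [^] m \<otimes> z [^] n = z [^] (m + n)" for m n :: nat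
      by (simp add: nat_pow_mult)
    have zz2: "z [^] m \<otimes> (z [^] n \<otimes> b) = z [^] (m + n) \<otimes> b" if "b \<in> carrier G" for b and m n :: nat
      using that by (simp add: m_assoc[symmetric] nat_pow_mult)
    note z_norm = m_assoc zz1 zz2
      zc[of g] zc[of h] zc[of "u [^] e"] zc[of "u [^] e'"] zc[of "t [^] f"] zc[of "t [^] f'"]
      zc1[of g] zc1[of h] zc1[of "u [^] e"] zc1[of "u [^] e'"] zc1[of "t [^] f"] zc1[of "t [^] f'"]
    have "\<phi> (g \<otimes> h) = (g \<otimes> h) \<otimes> \<tau> (e + e') (f + f')"
    proof -
      have "z [^] \<epsilon> (g \<otimes> h) = z [^] (e + e')" "z [^] \<delta> (g \<otimes> h) = z [^] (f + f')"
        by (simp_all add: \<epsilon>[symmetric] \<delta>[symmetric] cmt_mult_left e_def f_def e'_def f'_def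
            nat_pow_mult[symmetric])
      then have "\<epsilon> (g \<otimes> h) mod 2 = (e + e') mod 2" "\<delta> (g \<otimes> h) mod 2 = (f + f') mod 2"
        by (auto intro: mod_cong)
      then show ?thesis
        unfolding \<phi>_def by (subst (1 2) \<tau>_mod) simp
    qed
    also have "\<dots> = z [^] (f' * e + e' * f + e * f + e' * f') \<otimes> (g \<otimes> (h \<otimes> (u [^] e \<otimes> (u [^] e' \<otimes> (t [^] f \<otimes> t [^] f')))))"
    proof -
      have "(e + e') * (f + f') = f' * e + e' * f + e * f + e' * f'" by (simp add: algebra_simps)
      moreover have "u [^] (e + e') = u [^] e \<otimes> u [^] e'" "t [^] (f + f') = t [^] f \<otimes> t [^] f'"
        by (simp_all add: nat_pow_mult)
      ultimately show ?thesis
        unfolding \<tau>_def by (simp only:) (simp add: z_norm)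
    qed
    also have "\<dots> = z [^] (f' * e + e' * f + e * f + e' * f') \<otimes> (g \<otimes> (h \<otimes> (u [^] e \<otimes> (t [^] f \<otimes> (u [^] e' \<otimes> t [^] f')))))"
    proof -
      have "u [^] e' \<otimes> (t [^] f \<otimes> t [^] f') = t [^] f \<otimes> (u [^] e' \<otimes> t [^] f')"
        by (simp add: m_assoc[symmetric] tu')
      then show ?thesis by simp
    qed
    also have "\<dots> = z [^] (e * f) \<otimes> z [^] (e' * f') \<otimes> (g \<otimes> (u [^] e \<otimes> (t [^] f \<otimes> h)) \<otimes> (u [^] e' \<otimes> t [^] f'))"
    proof -
      have "u [^] e \<otimes> (t [^] f \<otimes> h) = z [^] (e' * f) \<otimes> (u [^] e \<otimes> h) \<otimes> t [^] f"
        by (simp add: ht z_norm)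
      also have "\<dots> = z [^] (f' * e + e' * f) \<otimes> (h \<otimes> (u [^] e \<otimes> t [^] f))"
        by (simp add: hu z_norm add.commute)
      finally have *: "u [^] e \<otimes> (t [^] f \<otimes> h) = z [^] (f' * e + e' * f) \<otimes> (h \<otimes> (u [^] e \<otimes> t [^] f))" .
      show ?thesis
        unfolding * by (simp add: z_norm ac_simps)
    qed
    also have "\<dots> = \<phi> g \<otimes> \<phi> h"
      by (simp add: \<phi>_def \<tau>_def e_def[symmetric] f_def[symmetric] e'_def[symmetric] f'_def[symmetric] z_norm add.commute)
    finally show "\<phi> (g \<otimes> h) = \<phi> g \<otimes> \<phi> h" .
  qed (simp add: \<phi>_def)
  moreover have "g = \<one>" if g [simp]: "g \<in> carrier G" and 1: "\<phi> g = \<one>" for g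
  proof -
    \<comment> \<open>\<open>\<tau> e f\<close> commutes with \<open>t\<close> and \<open>u\<close>,
      so \<open>\<phi>\<close> preserves \<open>\<epsilon>\<close> and \<open>\<delta>\<close>. Both
      vanish on the kernel, where \<open>\<phi>\<close> is therefore the identity.\<close>
    have "cmt u t = \<one>" using tu cmt_eq_one_commute[of t u] by simp
    then have "cmt (\<tau> e f) t = \<one>" "cmt (\<tau> e f) u = \<one>" for e f
      using z(1) tu by (simp_all add: \<tau>_def cmt_mult_left cmt_pow_left)
    then have "cmt (\<phi> g) t = cmt g t" "cmt (\<phi> g) u = cmt g u"
      by (simp_all add: \<phi>_def cmt_mult_left)
    then have "\<epsilon> g = 0" "\<delta> g = 0" using 1 by (simp_all add: \<epsilon>_def \<delta>_def)
    then show ?thesis using 1 by (simp add: \<phi>_def \<tau>_def)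
  qed
  ultimately have "\<phi> \<in> iso G G" by (intro iso_self_if_trivial_kernel) auto
  \<comment> \<open>\<open>\<epsilon> x = 0\<close> and \<open>\<delta> x = 1\<close>, so the factor
    is just \<open>t\<close>.\<close>
  moreover have "\<phi> x = y"
    using xt z(2) by (simp add: \<phi>_def \<tau>_def \<epsilon>_def \<delta>_def z_def[symmetric] t_def)
  ultimately show ?thesis unfolding aut_orbit_def by blast
qed

end

section \<open>Symplectic decompositions\<close>

lemma (in group) finite_subgroupI:
  assumes "finite (carrier G)" and "S \<subseteq> carrier G" and "\<one> \<in> S"
    and closed: "\<And>x y. \<lbrakk>x \<in> S; y \<in> S\<rbrakk> \<Longrightarrow> x \<otimes> y \<in> S"
  shows "subgroup S G"
proof (rule subgroupI)
  fix x assume x: "x \<in> S"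
  then have c: "x \<in> carrier G" using assms by blast
  have pow: "x [^] n \<in> S" for n :: nat
    by (induction n) (use x assms in auto)
  have "order G > 0"
    using assms(1) order_gt_0_iff_finite by blast
  then have "x [^] (order G - 1) \<otimes> x = \<one>"
    using c pow_order_eq_1[of x] nat_pow_Suc[of x "order G - 1"] by simp
  then have "inv x = x [^] (order G - 1)"
    using c by (intro inv_equality) auto
  then show "inv x \<in> S" using pow by simp
qed (use assms in auto)

context extraspecial
begin

text \<open>A nondegenerate subspace of the symplectic space \<open>G/Z\<close>, represented by its
  full preimage in \<open>G\<close>, so that induction on dimension becomes induction on
  \<open>card C\<close>.\<close>

definition nondegenerate :: "'a set \<Rightarrow> bool" where
  "nondegenerate C \<longleftrightarrow> subgroup C G \<and> Z \<subseteq> C \<and> (\<forall>c\<in>C. (\<forall>d\<in>C. cmt c d = \<one>) \<longrightarrow> c \<in> Z)"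

lemma nondegenerate_carrier: "nondegenerate (carrier G)"
  unfolding nondegenerate_def using noncentral_cmt by (auto simp: subgroup_self)

text \<open>Splits off the hyperbolic plane spanned by \<open>x\<close> and \<open>y\<close>, with
  \<open>C'\<close> as orthogonal complement. The strict drop in cardinality drives the later
  inductions.\<close>

lemma nondegenerate_commutant:
  assumes C: "nondegenerate C" and x: "x \<in> C" and y: "y \<in> C" and xy: "cmt x y \<noteq> \<one>"
  defines "C' \<equiv> {c \<in> C. cmt c x = \<one> \<and> cmt c y = \<one>}"
  shows "nondegenerate C'" and "card C' < card C"
    and "\<And>c. c \<in> C \<Longrightarrow> \<exists>(i::nat) (j::nat) d. d \<in> C' \<and> c = x [^] i \<otimes> (y [^] j \<otimes> d)"
proof -
  have sub: "subgroup C G" and ZC: "Z \<subseteq> C" using C by (simp_all add: nondegenerate_def)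
  have car [simp]: "c \<in> carrier G" if "c \<in> C" for c
    using that subgroup.mem_carrier[OF sub] by simp
  have [simp]: "x \<in> carrier G" "y \<in> carrier G" using x y by simp_all
  have yx: "cmt y x \<noteq> \<one>" using xy cmt_eq_one_commute[of x y] by simp
  show dec: "\<exists>(i::nat) (j::nat) d. d \<in> C' \<and> c = x [^] i \<otimes> (y [^] j \<otimes> d)" if c: "c \<in> C" for c
  proof -
    have [simp]: "c \<in> carrier G" using c by simp
    \<comment> \<open>The coordinates of \<open>c\<close> in the plane are read off from its
      commutators with the opposite basis vectors; dividing by \<open>b\<close> leaves a part
      commuting with both.\<close>
    obtain i :: nat where i: "cmt c y = cmt x y [^] i"
      using Z_powers[of "cmt x y" "cmt c y"] xy by auto
    obtain j :: nat where j: "cmt c x = cmt y x [^] j"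
      using Z_powers[of "cmt y x" "cmt c x"] yx by auto
    define b where "b = x [^] i \<otimes> y [^] j"
    define d where "d = inv b \<otimes> c"
    have b: "b \<in> C" using sub x y by (simp add: b_def subgroup.m_closed subgroup_pow_closed)
    then have d: "d \<in> C" using sub c by (simp add: d_def subgroup.m_closed subgroup.m_inv_closed)
    have [simp]: "b \<in> carrier G" "d \<in> carrier G" using b d by simp_all
    have bd: "c = b \<otimes> d" by (simp add: d_def)
    have "cmt b y = cmt c y" "cmt b x = cmt c x"
      by (simp_all add: b_def cmt_mult_left cmt_pow_left i j)
    then have "cmt d y = \<one>" "cmt d x = \<one>"
      by (simp_all add: bd cmt_mult_left)
    then show ?thesis
      using d bd by (intro exI[of _ i] exI[of _ j] exI[of _ d]) (simp add: C'_def b_def m_assoc)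
  qed
  have sub': "subgroup C' G"
  proof (rule finite_subgroupI)
    show "\<one> \<in> C'" using sub by (simp add: C'_def subgroup.one_closed)
    show "a \<otimes> b \<in> C'" if "a \<in> C'" "b \<in> C'" for a b
      using that sub by (auto simp: C'_def cmt_mult_left subgroup.m_closed)
  qed (auto simp: C'_def)
  have "c \<in> Z" if c: "c \<in> C'" "\<forall>d\<in>C'. cmt c d = \<one>" for c
  proof -
    have [simp]: "c \<in> carrier G" using c by (simp add: C'_def)
    \<comment> \<open>An element of \<open>C'\<close> that commutes with \<open>C'\<close> also
      commutes with \<open>x\<close> and \<open>y\<close>, hence with all of
      \<open>C\<close>.\<close>
    have "cmt c g = \<one>" if g: "g \<in> C" for g
    proof -
      obtain i j :: nat and d where d: "d \<in> C'" "g = x [^] i \<otimes> (y [^] j \<otimes> d)"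
        using dec[OF g] by blast
      then have "d \<in> carrier G" by (simp add: C'_def)
      then show ?thesis
        using c d by (simp add: C'_def cmt_mult_right cmt_pow_right)
    qed
    then show ?thesis using C c(1) unfolding nondegenerate_def C'_def by blast
  qed
  moreover have "Z \<subseteq> C'"
    using ZC unfolding C'_def by auto
  ultimately show "nondegenerate C'"
    using sub' unfolding nondegenerate_def by blast
  have "x \<in> C" "x \<notin> C'" using x xy by (simp_all add: C'_def)
  then show "card C' < card C"
    using sub by (intro psubset_card_mono) (auto simp: C'_def intro: finite_subset[OF _ fin])
qed

text \<open>If \<open>v^p\<close> is nontrivial it generates \<open>Z\<close>, and multiplying
  \<open>w\<close> by a suitable power of \<open>v\<close> cancels \<open>w^p\<close> without
  changing \<open>[v, w]\<close>. Oddness makes \<open>p\<close>-th powers multiplicative.\<close>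

lemma ex_cmt_with_order_p:
  assumes "odd p" and C: "nondegenerate C" and "C \<noteq> Z"
  shows "\<exists>x\<in>C. \<exists>y\<in>C. cmt x y \<noteq> \<one> \<and> y [^] p = \<one>"
proof -
  have sub: "subgroup C G" and ZC: "Z \<subseteq> C" using C by (simp_all add: nondegenerate_def)
  obtain v where v: "v \<in> C" "v \<notin> Z" using assms(3) ZC by blast
  then obtain w where w: "w \<in> C" "cmt v w \<noteq> \<one>" using C by (auto simp: nondegenerate_def)
  have [simp]: "v \<in> carrier G" "w \<in> carrier G" using v w subgroup.mem_carrier[OF sub] by simp_all
  show ?thesis
  proof (cases "v [^] p = \<one>")
    case True
    then show ?thesis using v w cmt_eq_one_commute[of v w] by auto
  next
    case False
    obtain n :: nat where n: "inv (w [^] p) = (v [^] p) [^] n"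
      using Z_powers[of "v [^] p" "inv (w [^] p)"] False by auto
    define y where "y = w \<otimes> v [^] n"
    have y: "y \<in> C" using v w sub by (simp add: y_def subgroup.m_closed subgroup_pow_closed)
    have "cmt v y = cmt v w" by (simp add: y_def cmt_mult_right cmt_pow_right)
    moreover have "y [^] p = \<one>"
    proof -
      have "(v [^] n) [^] p = (v [^] p) [^] n" by (simp add: nat_pow_pow mult.commute)
      then have "y [^] p = w [^] p \<otimes> inv (w [^] p)"
        using assms(1) n by (simp add: y_def pow_p_mult_odd)
      then show ?thesis by simp
    qed
    ultimately show ?thesis using v w y by metis
  qed
qed

lemma subgroup_cyclic_extension:
  assumes H: "subgroup H G" and x [simp]: "x \<in> carrier G" and comm: "\<And>h. h \<in> H \<Longrightarrow> cmt h x = \<one>"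
  shows "subgroup {x [^] (i::nat) \<otimes> h | i h. h \<in> H} G"
proof (rule finite_subgroupI)
  have car [simp]: "h \<in> carrier G" if "h \<in> H" for h
    using that subgroup.mem_carrier[OF H] by simp
  show "{x [^] (i::nat) \<otimes> h | i h. h \<in> H} \<subseteq> carrier G" by auto
  show "\<one> \<in> {x [^] (i::nat) \<otimes> h | i h. h \<in> H}"
    using H by (auto intro!: exI[of _ 0] exI[of _ \<one>] simp: subgroup.one_closed)
  fix a b assume "a \<in> {x [^] (i::nat) \<otimes> h | i h. h \<in> H}" "b \<in> {x [^] (i::nat) \<otimes> h | i h. h \<in> H}"
  then obtain i j :: nat and h k where ab: "a = x [^] i \<otimes> h" "b = x [^] j \<otimes> k" "h \<in> H" "k \<in> H" by blast
  then have "h \<otimes> x [^] j = x [^] j \<otimes> h"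
    using comm by (simp add: cmt_pow_right flip: cmt_eq_one_iff)
  then have "a \<otimes> b = x [^] i \<otimes> (x [^] j \<otimes> h) \<otimes> k"
    using ab by (simp add: m_assoc flip: m_assoc[of h "x [^] j" k])
  then have "a \<otimes> b = x [^] (i + j) \<otimes> (h \<otimes> k)"
    using ab by (simp add: m_assoc flip: nat_pow_mult)
  moreover have "h \<otimes> k \<in> H" using ab H by (simp add: subgroup.m_closed)
  ultimately show "a \<otimes> b \<in> {x [^] (i::nat) \<otimes> h | i h. h \<in> H}" by blast
qed simp

text \<open>Lifts a splitting of \<open>C/Z\<close> into two Lagrangian subspaces: of each
  hyperbolic pair, \<open>x\<close> joins \<open>A\<close> and \<open>y\<close> joins
  \<open>B\<close>. The choice \<open>y^p = 1\<close> keeps \<open>B\<close> clear of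
  \<open>Z\<close>, so that the factors meet trivially in \<open>G\<close> and not only modulo
  \<open>Z\<close>.\<close>

lemma complemented_abelian_subgroup:
  assumes p: "odd p" and "nondegenerate C"
  shows "\<exists>A B. subgroup A G \<and> subgroup B G \<and> Z \<subseteq> A \<and> A \<subseteq> C \<and> B \<subseteq> C \<and> A \<inter> B \<subseteq> {\<one>} \<and>
    (\<forall>a\<in>A. \<forall>a'\<in>A. cmt a a' = \<one>) \<and> (\<forall>c\<in>C. \<exists>a\<in>A. \<exists>b\<in>B. c = a \<otimes> b)"
  using assms(2)
proof (induction "card C" arbitrary: C rule: less_induct)
  case less
  show ?case
  proof (cases "C = Z")
    case True
    have "\<forall>c\<in>Z. \<exists>a\<in>Z. \<exists>b\<in>{\<one>}. c = a \<otimes> b" by auto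
    then show ?thesis
      using True subgroup_Z by (intro exI[of _ Z] exI[of _ "{\<one>}"]) (simp add: triv_subgroup)
  next
    case False
    obtain x y where xy: "x \<in> C" "y \<in> C" "cmt x y \<noteq> \<one>" and yp: "y [^] p = \<one>"
      using ex_cmt_with_order_p[OF p less.prems False] by blast
    have sub: "subgroup C G" using less.prems by (simp add: nondegenerate_def)
    have car: "c \<in> carrier G" if "c \<in> C" for c
      using that subgroup.mem_carrier[OF sub] by simp
    have [simp]: "x \<in> carrier G" "y \<in> carrier G" using xy car by blast+
    have yx: "cmt y x \<noteq> \<one>" using xy cmt_eq_one_commute[of x y] by simp
    define D where "D = {c \<in> C. cmt c x = \<one> \<and> cmt c y = \<one>}"
    note D = nondegenerate_commutant[OF less.prems xy, folded D_def]
    obtain A B where A: "subgroup A G" and B: "subgroup B G" and AB: "Z \<subseteq> A" "A \<subseteq> D" "B \<subseteq> D"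
      "A \<inter> B \<subseteq> {\<one>}" "\<forall>a\<in>A. \<forall>a'\<in>A. cmt a a' = \<one>" and split: "\<forall>c\<in>D. \<exists>a\<in>A. \<exists>b\<in>B. c = a \<otimes> b"
      using less.hyps[OF D(2,1)] by blast
    have cx: "cmt c x = \<one>" and cy: "cmt c y = \<one>" and xc: "cmt x c = \<one>" and c: "c \<in> C"
      and cc: "c \<in> carrier G" if "c \<in> A \<or> c \<in> B" for c
      using that AB car cmt_eq_one_commute[of c x] by (auto simp: D_def)
    define A' where "A' = {x [^] (i::nat) \<otimes> h | i h. h \<in> A}"
    define B' where "B' = {y [^] (i::nat) \<otimes> h | i h. h \<in> B}"
    have "subgroup A' G" unfolding A'_def
      using A cx by (intro subgroup_cyclic_extension) auto
    moreover have "subgroup B' G" unfolding B'_def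
      using B cy by (intro subgroup_cyclic_extension) auto
    moreover have "A \<subseteq> A'"
    proof
      fix a assume "a \<in> A"
      moreover from this have "a = x [^] (0::nat) \<otimes> a" using cc by simp
      ultimately show "a \<in> A'" unfolding A'_def by blast
    qed
    moreover have "A' \<subseteq> C" "B' \<subseteq> C"
      using sub xy c unfolding A'_def B'_def by (auto simp: subgroup.m_closed subgroup_pow_closed)
    moreover have "A' \<inter> B' \<subseteq> {\<one>}"
    proof
      fix g assume "g \<in> A' \<inter> B'"
      then obtain i j :: nat and a b where g: "g = x [^] i \<otimes> a" "g = y [^] j \<otimes> b" and ab: "a \<in> A" "b \<in> B"
        unfolding A'_def B'_def by blast
      have [simp]: "a \<in> carrier G" "b \<in> carrier G" using cc ab by blast+
      \<comment> \<open>Comparing commutators with \<open>y\<close> and then with \<open>x\<close>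
        shows that \<open>p\<close> divides \<open>i\<close> and \<open>j\<close>. So
        \<open>x^i\<close> lies in \<open>Z\<close>, \<open>y^j\<close> is 1, and \<open>g\<close>
        falls into \<open>A \<inter> B\<close>.\<close>
      have "cmt (x [^] i \<otimes> a) y = cmt (y [^] j \<otimes> b) y" using g by simp
      then have "cmt x y [^] i = \<one>"
        using ab cy by (simp add: cmt_mult_left cmt_pow_left)
      then obtain k where k: "i = p * k" using xy by (auto simp: Z_pow_eq_one_iff)
      have "cmt (x [^] i \<otimes> a) x = cmt (y [^] j \<otimes> b) x" using g by simp
      then have "cmt y x [^] j = \<one>"
        using ab cx by (simp add: cmt_mult_left cmt_pow_left)
      then obtain l where l: "j = p * l" using yx by (auto simp: Z_pow_eq_one_iff)
      have "y [^] j = \<one>" using yp by (simp add: l flip: nat_pow_pow)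
      then have "g \<in> B" using g ab by simp
      moreover have "x [^] i \<in> Z" by (simp add: k flip: nat_pow_pow)
      then have "x [^] i \<otimes> a \<in> A" using A AB(1) ab by (auto intro: subgroup.m_closed)
      then have "g \<in> A" using g by simp
      ultimately show "g \<in> {\<one>}" using AB(4) by blast
    qed
    moreover have "\<forall>a\<in>A'. \<forall>a'\<in>A'. cmt a a' = \<one>"
    proof (intro ballI)
      fix g h assume "g \<in> A'" "h \<in> A'"
      then obtain i j :: nat and a b where g: "g = x [^] i \<otimes> a" "h = x [^] j \<otimes> b" and ab: "a \<in> A" "b \<in> A"
        unfolding A'_def by blast
      have [simp]: "a \<in> carrier G" "b \<in> carrier G" using cc ab by blast+
      show "cmt g h = \<one>"
        using ab AB(5) cx xc by (simp add: g cmt_mult_left cmt_mult_right cmt_pow_left cmt_pow_right)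
    qed
    moreover have "\<forall>c\<in>C. \<exists>a\<in>A'. \<exists>b\<in>B'. c = a \<otimes> b"
    proof
      fix g assume "g \<in> C"
      then obtain i j :: nat and d where d: "d \<in> D" "g = x [^] i \<otimes> (y [^] j \<otimes> d)"
        using D(3) by blast
      then obtain a b where ab: "a \<in> A" "b \<in> B" "d = a \<otimes> b" using split by blast
      have [simp]: "a \<in> carrier G" "b \<in> carrier G" using cc ab by blast+
      have "y [^] j \<otimes> a = a \<otimes> y [^] j"
        using ab(1) cy[of a] cmt_eq_one_iff[of a "y [^] j"] by (simp add: cmt_pow_right)
      have "g = x [^] i \<otimes> ((y [^] j \<otimes> a) \<otimes> b)"
        using d ab by (simp add: m_assoc)
      also have "\<dots> = (x [^] i \<otimes> a) \<otimes> (y [^] j \<otimes> b)"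
        unfolding \<open>y [^] j \<otimes> a = a \<otimes> y [^] j\<close> by (simp add: m_assoc)
      finally have "g = (x [^] i \<otimes> a) \<otimes> (y [^] j \<otimes> b)" .
      moreover have "x [^] i \<otimes> a \<in> A'" "y [^] j \<otimes> b \<in> B'"
        using ab unfolding A'_def B'_def by blast+
      ultimately show "\<exists>a\<in>A'. \<exists>b\<in>B'. g = a \<otimes> b" by blast
    qed
    ultimately show ?thesis using AB(1) by (intro exI[of _ A'] exI[of _ B']) auto
  qed
qed

text \<open>Raising the abelian factor of a decomposition \<open>G = A B\<close> to a power prime to \<open>p\<close> is an automorphism,
  because it commutes with conjugation.\<close>

lemma ex_aut_power_on_Z:
  assumes p: "odd p" and m: "coprime m p"
  shows "\<exists>\<phi>\<in>iso G G. \<forall>z\<in>Z. \<phi> z = z [^] (m::nat)"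
proof -
  obtain A B where A: "subgroup A G" and B: "subgroup B G" and ZA: "Z \<subseteq> A"
    and AB: "A \<inter> B \<subseteq> {\<one>}" and abel: "\<And>a a'. \<lbrakk>a \<in> A; a' \<in> A\<rbrakk> \<Longrightarrow> cmt a a' = \<one>"
    and split: "\<forall>c\<in>carrier G. \<exists>a\<in>A. \<exists>b\<in>B. c = a \<otimes> b"
    using complemented_abelian_subgroup[OF p nondegenerate_carrier] by blast
  have [simp]: "a \<in> carrier G" if "a \<in> A" for a using that subgroup.mem_carrier[OF A] by simp
  have [simp]: "b \<in> carrier G" if "b \<in> B" for b using that subgroup.mem_carrier[OF B] by simp
  have unique: "a = a' \<and> b = b'" if "a \<otimes> b = a' \<otimes> b'" and in_AB: "a \<in> A" "a' \<in> A" "b \<in> B" "b' \<in> B" for a a' b b'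
  proof -
    have "inv a' \<otimes> a = b' \<otimes> inv b"
    proof -
      have "inv a' \<otimes> a = inv a' \<otimes> (a \<otimes> b) \<otimes> inv b" using in_AB by (simp add: m_assoc)
      also have "\<dots> = b' \<otimes> inv b" using in_AB by (simp add: that(1) m_assoc)
      finally show ?thesis .
    qed
    moreover have "inv a' \<otimes> a \<in> A" "b' \<otimes> inv b \<in> B"
      using in_AB A B by (simp_all add: subgroup.m_closed subgroup.m_inv_closed)
    ultimately have 1: "inv a' \<otimes> a = \<one>" using AB by auto
    have "a = a' \<otimes> (inv a' \<otimes> a)" using in_AB by simp
    then have "a = a'" using 1 in_AB by simp
    then show ?thesis using that by simp
  qed
  define \<phi> where "\<phi> g = (THE h. \<exists>a\<in>A. \<exists>b\<in>B. g = a \<otimes> b \<and> h = a [^] m \<otimes> b)" for g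
  have \<phi>: "\<phi> (a \<otimes> b) = a [^] m \<otimes> b" if "a \<in> A" "b \<in> B" for a b
    unfolding \<phi>_def using that unique by (intro the_equality) blast+
  have "\<phi> \<in> hom G G"
  proof (rule homI)
    fix g h assume "g \<in> carrier G" "h \<in> carrier G"
    then obtain a b c d where *: "g = a \<otimes> b" "h = c \<otimes> d" "a \<in> A" "c \<in> A" "b \<in> B" "d \<in> B"
      using split by meson
    define z where "z = cmt b c"
    have z: "z \<in> Z" using * by (simp add: z_def)
    have "z \<otimes> c \<in> A" using z ZA A * by (auto intro: subgroup.m_closed)
    have "g \<otimes> h = a \<otimes> (b \<otimes> c) \<otimes> d" using * by (simp add: m_assoc)
    also have "b \<otimes> c = z \<otimes> (c \<otimes> b)" unfolding z_def using * by (intro cmt_mult) simp_all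
    also have "a \<otimes> (z \<otimes> (c \<otimes> b)) \<otimes> d = (a \<otimes> (z \<otimes> c)) \<otimes> (b \<otimes> d)" using * z by (simp add: m_assoc)
    finally have "\<phi> (g \<otimes> h) = (a \<otimes> (z \<otimes> c)) [^] m \<otimes> (b \<otimes> d)"
      using * A B \<open>z \<otimes> c \<in> A\<close> \<phi> by (simp add: subgroup.m_closed)
    also have "(a \<otimes> (z \<otimes> c)) [^] m = a [^] m \<otimes> (z [^] m \<otimes> c [^] m)"
      using * z \<open>z \<otimes> c \<in> A\<close> abel by (simp add: pow_mult_commuting)
    also have "a [^] m \<otimes> (z [^] m \<otimes> c [^] m) \<otimes> (b \<otimes> d) = a [^] m \<otimes> (z [^] m \<otimes> (c [^] m \<otimes> b)) \<otimes> d"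
      using * z by (simp add: m_assoc)
    \<comment> \<open>\<open>[b, c^m] = z^m\<close>: the power map scales the central factor by
      exactly what it costs to move \<open>b\<close> past \<open>c^m\<close>.\<close>
    also have "z [^] m \<otimes> (c [^] m \<otimes> b) = b \<otimes> c [^] m"
      using * cmt_mult[of b "c [^] m"] by (simp add: cmt_pow_right z_def)
    also have "a [^] m \<otimes> (b \<otimes> c [^] m) \<otimes> d = \<phi> g \<otimes> \<phi> h"
      using * by (simp add: \<phi> m_assoc)
    finally show "\<phi> (g \<otimes> h) = \<phi> g \<otimes> \<phi> h" .
  next
    fix g assume "g \<in> carrier G"
    then obtain a b where "g = a \<otimes> b" "a \<in> A" "b \<in> B" using split by meson
    then show "\<phi> g \<in> carrier G" by (simp add: \<phi>)
  qed
  moreover have "g = \<one>" if "g \<in> carrier G" "\<phi> g = \<one>" for g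
  proof -
    obtain a b where g: "g = a \<otimes> b" "a \<in> A" "b \<in> B" using split \<open>g \<in> carrier G\<close> by meson
    then have "a [^] m \<otimes> b = \<one> \<otimes> \<one>" using that by (simp add: \<phi>)
    then have 1: "a [^] m = \<one>" "b = \<one>"
      using unique[of "a [^] m" b \<one> \<one>] g A B by (auto simp: subgroup_pow_closed subgroup.one_closed)
    \<comment> \<open>\<open>m\<close> is prime to the group order, so \<open>a^m = 1\<close> forces
      \<open>a = 1\<close>.\<close>
    obtain n where n: "card (carrier G) = p ^ n" using order_prime_power by blast
    have "ord a dvd m" "ord a dvd p ^ n"
      using 1 g pow_eq_id[of a m] ord_dvd_group_order[of a] n by (simp_all add: order_def)
    moreover have "coprime m (p ^ n)" using m by simp
    ultimately have "ord a = 1" using coprime_common_divisor_nat by blast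
    then show ?thesis using g 1 ord_eq_1[of a] by simp
  qed
  ultimately have "\<phi> \<in> iso G G" by (intro iso_self_if_trivial_kernel) auto
  moreover have "\<phi> z = z [^] m" if "z \<in> Z" for z
    using \<phi>[of z \<one>] that ZA B by (auto simp: subgroup.one_closed)
  ultimately show ?thesis by blast
qed

text \<open>For \<open>p = 2\<close> there is only one nontrivial central element. For odd
  \<open>p\<close>, \<open>z'\<close> is a power of \<open>z\<close> with exponent prime to
  \<open>p\<close>, and that power map on \<open>Z\<close> extends to \<open>G\<close>.\<close>

lemma aut_orbit_Z:
  assumes z: "z \<in> Z" "z \<noteq> \<one>" and z': "z' \<in> Z" "z' \<noteq> \<one>"
  shows "aut_orbit z z'"
proof -
  obtain n where n: "n < p" "z' = z [^] (n::nat)" using Z_powers[OF z z'(1)] by blast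
  have n0: "n \<noteq> 0" using n z' by (cases n) auto
  show ?thesis
  proof (cases "p = 2")
    case True
    then have "n = 1" using n n0 by simp
    then have "z' = z" using n z by simp
    then show ?thesis by (simp add: aut_orbit_refl)
  next
    case False
    then have "odd p" using prime_p prime_odd_nat p_gt_1 by fastforce
    moreover have "coprime n p"
      using n n0 prime_p by (metis coprime_commute prime_imp_coprime nat_dvd_not_less neq0_conv)
    ultimately obtain \<phi> where "\<phi> \<in> iso G G" "\<forall>z\<in>Z. \<phi> z = z [^] n"
      using ex_aut_power_on_Z by blast
    then show ?thesis unfolding aut_orbit_def using n z by auto
  qed
qed

text \<open>The commutator pairing of \<open>G/Z\<close> is perfect.\<close>

lemma hom_to_Z_is_commutator:
  assumes "nondegenerate C" and "\<And>c. c \<in> C \<Longrightarrow> f c \<in> Z" and "\<And>z. z \<in> Z \<Longrightarrow> f z = \<one>"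
    and "\<And>c d. \<lbrakk>c \<in> C; d \<in> C\<rbrakk> \<Longrightarrow> f (c \<otimes> d) = f c \<otimes> f d"
  shows "\<exists>u\<in>C. \<forall>g\<in>C. cmt g u = f g"
  using assms
proof (induction "card C" arbitrary: C rule: less_induct)
  case less
  have sub: "subgroup C G" and ZC: "Z \<subseteq> C" using less.prems(1) by (simp_all add: nondegenerate_def)
  have car: "c \<in> carrier G" if "c \<in> C" for c
    using that subgroup.mem_carrier[OF sub] by simp
  show ?case
  proof (cases "C = Z")
    case True
    then show ?thesis using less.prems(3) by (intro bexI[of _ \<one>]) auto
  next
    case False
    then obtain x where "x \<in> C" "x \<notin> Z" using ZC by blast
    then obtain y where xy: "x \<in> C" "y \<in> C" "cmt x y \<noteq> \<one>"
      using less.prems(1) by (auto simp: nondegenerate_def)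
    have [simp]: "x \<in> carrier G" "y \<in> carrier G" using xy car by blast+
    have yx: "cmt y x \<noteq> \<one>" using xy cmt_eq_one_commute[of x y] by simp
    define D where "D = {c \<in> C. cmt c x = \<one> \<and> cmt c y = \<one>}"
    note D = nondegenerate_commutant[OF less.prems(1) xy, folded D_def]
    have DC: "D \<subseteq> C" by (auto simp: D_def)
    have "\<exists>u\<in>D. \<forall>g\<in>D. cmt g u = f g"
    proof (rule less.hyps[OF D(2,1)])
      show "f (c \<otimes> d) = f c \<otimes> f d" if "c \<in> D" "d \<in> D" for c d
        using that DC by (intro less.prems(4)) blast+
      show "f c \<in> Z" if "c \<in> D" for c using that DC by (intro less.prems(2)) blast
    qed (rule less.prems(3))
    then obtain v where v: "v \<in> D" "\<forall>g\<in>D. cmt g v = f g" by blast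
    obtain i :: nat where i: "f x = cmt x y [^] i"
      using Z_powers[of "cmt x y" "f x"] xy less.prems(2) by auto
    obtain j :: nat where j: "f y = cmt y x [^] j"
      using Z_powers[of "cmt y x" "f y"] xy yx less.prems(2) by auto
    have [simp]: "v \<in> carrier G" using v(1) DC car by blast
    have xv: "cmt x v = \<one>" and yv: "cmt y v = \<one>"
      using v(1) cmt_eq_one_commute[of v x] cmt_eq_one_commute[of v y] by (auto simp: D_def)
    \<comment> \<open>\<open>v\<close> represents \<open>f\<close> on \<open>D\<close>. The powers
      of \<open>y\<close> and \<open>x\<close> correct the values at \<open>x\<close> and
      \<open>y\<close>, and change nothing on \<open>D\<close>, which commutes with both.\<close>
    define u where "u = v \<otimes> (y [^] i \<otimes> x [^] j)"
    have u: "u \<in> C" using xy v DC sub by (auto simp: u_def intro!: subgroup.m_closed subgroup_pow_closed)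
    have [simp]: "u \<in> carrier G" using u car by blast
    have xu: "cmt x u = f x" using xv i by (simp add: u_def cmt_mult_right cmt_pow_right)
    have yu: "cmt y u = f y" using yv j by (simp add: u_def cmt_mult_right cmt_pow_right)
    have f_pow: "f (c [^] n) = f c [^] n" if "c \<in> C" for c and n :: nat
    proof (induction n)
      case 0
      then show ?case using less.prems(3)[of \<one>] by simp
    next
      case (Suc n)
      then show ?case using less.prems(4)[of "c [^] n" c] that sub by (simp add: subgroup_pow_closed)
    qed
    have "cmt g u = f g" if "g \<in> C" for g
    proof -
      obtain k l :: nat and d where d: "d \<in> D" "g = x [^] k \<otimes> (y [^] l \<otimes> d)"
        using D(3) \<open>g \<in> C\<close> by blast
      have dC: "d \<in> C" using d DC by blast
      then have [simp]: "d \<in> carrier G" using car by blast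
      have "cmt d u = cmt d v" using d by (simp add: u_def D_def cmt_mult_right cmt_pow_right)
      then have "cmt d u = f d" using v d by simp
      then have "cmt g u = f x [^] k \<otimes> (f y [^] l \<otimes> f d)"
        by (simp add: d cmt_mult_left cmt_pow_left xu yu)
      also have "\<dots> = f g"
        using xy dC sub by (simp add: d f_pow less.prems(4) subgroup_pow_closed subgroup.m_closed)
      finally show ?thesis .
    qed
    then show ?thesis using u by blast
  qed
qed

end

section \<open>Word images\<close>

context group
begin

lemma word_image_candidate_closed:
  assumes "word_image_candidate G A" and "x \<in> A" and "aut_orbit x y"
  shows "y \<in> A"
  using assms unfolding word_image_candidate_def aut_orbit_def by blast

text \<open>A word image candidate is a union of automorphism orbits; here the orbits are the fibres of \<open>f\<close>.\<close>

lemma card_word_image_candidates: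
  assumes fin: "finite (carrier G)"
    and inv: "\<And>\<phi> x. \<lbrakk>\<phi> \<in> iso G G; x \<in> carrier G\<rbrakk> \<Longrightarrow> f (\<phi> x) = f x"
    and orbit: "\<And>x y. \<lbrakk>x \<in> carrier G; y \<in> carrier G; f x = f y\<rbrakk> \<Longrightarrow> aut_orbit x y"
  shows "card {A. word_image_candidate G A} = 2 ^ (card (f ` carrier G) - 1)"
proof -
  \<comment> \<open>The value at the identity is left out because every candidate contains its
    orbit; the other orbits are free choices.\<close>
  let ?K = "f ` carrier G - {f \<one>}"
  define R where "R S = {x \<in> carrier G. f x \<in> insert (f \<one>) S}" for S
  have one: "x = \<one>" if "x \<in> carrier G" "f x = f \<one>" for x
    using orbit[of \<one> x] that iso_self_one unfolding aut_orbit_def by auto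
  have "bij_betw (\<lambda>A. f ` A - {f \<one>}) {A. word_image_candidate G A} (Pow ?K)"
  proof (rule bij_betw_byWitness[where f' = R])
    show "\<forall>A\<in>{A. word_image_candidate G A}. R (f ` A - {f \<one>}) = A"
    proof (intro ballI subset_antisym subsetI)
      fix A x assume "A \<in> {A. word_image_candidate G A}"
      then have A: "word_image_candidate G A" by simp
      then have sub: "A \<subseteq> carrier G" "\<one> \<in> A" by (simp_all add: word_image_candidate_def)
      show "x \<in> A" if "x \<in> R (f ` A - {f \<one>})"
      proof -
        have x: "x \<in> carrier G" and "f x = f \<one> \<or> f x \<in> f ` A"
          using that by (auto simp: R_def)
        then obtain y where "y \<in> A" "f y = f x" using sub(2) by (metis imageE)
        then show ?thesis
          using word_image_candidate_closed[OF A] orbit[of y x] sub(1) x by blast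
      qed
      show "x \<in> R (f ` A - {f \<one>})" if "x \<in> A"
        using that sub by (auto simp: R_def)
    qed
    show "\<forall>S\<in>Pow ?K. f ` R S - {f \<one>} = S"
      unfolding R_def by auto
    show "(\<lambda>A. f ` A - {f \<one>}) ` {A. word_image_candidate G A} \<subseteq> Pow ?K"
      by (auto simp: word_image_candidate_def)
    show "R ` Pow ?K \<subseteq> {A. word_image_candidate G A}"
    proof (intro image_subsetI CollectI)
      fix S
      have "\<phi> x \<in> R S" if "\<phi> \<in> iso G G" "x \<in> R S" for \<phi> x
        using that inv iso_self_closed by (auto simp: R_def)
      then show "word_image_candidate G (R S)"
        unfolding word_image_candidate_def by (auto simp: R_def)
    qed
  qed
  then have "card {A. word_image_candidate G A} = card (Pow ?K)"
    by (rule bij_betw_same_card)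
  also have "\<dots> = 2 ^ card ?K" using fin by (simp add: card_Pow)
  finally show ?thesis using fin by (simp add: card_Diff_singleton)
qed

lemma word_eval_closed:
  "\<lbrakk>is_word d w; g \<in> {..<d} \<rightarrow> carrier G\<rbrakk> \<Longrightarrow> word_eval G w g \<in> carrier G"
proof (induction w)
  case (Cons l w)
  then show ?case by (cases l) (auto simp: is_word_def Pi_iff)
qed simp

lemma word_eval_one: "word_eval G w (\<lambda>_. \<one>) = \<one>"
  by (induction w) auto

lemma iso_self_word_eval:
  assumes "\<phi> \<in> iso G G" "g \<in> {..<d} \<rightarrow> carrier G" "is_word d w"
  shows "\<phi> (word_eval G w g) = word_eval G w (\<lambda>i. \<phi> (g i))"
  using assms(3)
proof (induction w)
  case Nil
  then show ?case using assms by (simp add: iso_self_one)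
next
  case (Cons l w)
  obtain i e where l: "l = (i, e)" by force
  have i: "g i \<in> carrier G" and w: "is_word d w"
    using Cons.prems assms(2) l by (auto simp: is_word_def)
  have "word_eval G w g \<in> carrier G"
    using word_eval_closed w assms(2) by blast
  then show ?case
    using Cons.IH[OF w] i assms(1) by (simp add: l iso_self_mult iso_self_inv)
qed

lemma word_image_candidate_word_image:
  assumes "is_word d w"
  shows "word_image_candidate G (word_image G d w)"
  unfolding word_image_candidate_def
proof (intro conjI ballI image_subsetI)
  show "word_image G d w \<subseteq> carrier G"
    using word_eval_closed assms by (auto simp: word_image_def)
  show "\<one> \<in> word_image G d w"
    unfolding word_image_def using word_eval_one[of w, symmetric] by blast
  fix \<phi> v assume \<phi>: "\<phi> \<in> iso G G" and "v \<in> word_image G d w"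
  then obtain g where g: "g \<in> {..<d} \<rightarrow> carrier G" "v = word_eval G w g"
    by (auto simp: word_image_def)
  then have "\<phi> v = word_eval G w (\<lambda>i. \<phi> (g i))"
    using iso_self_word_eval[OF \<phi> _ assms] by simp
  moreover have "(\<lambda>i. \<phi> (g i)) \<in> {..<d} \<rightarrow> carrier G"
    using g(1) iso_self_closed[OF \<phi>] by auto
  ultimately show "\<phi> v \<in> word_image G d w"
    unfolding word_image_def by blast
qed

text \<open>\<open>n\<close> is the exponent sum of letter \<open>k\<close>: with all other letters
  killed, the word map is a power map.\<close>

lemma word_eval_single_letter:
  "\<exists>n::int. \<forall>x\<in>carrier G. word_eval G w (\<lambda>i. if i = k then x else \<one>) = x [^] n"
proof (induction w)
  case Nil
  show ?case by (intro exI[of _ 0]) simp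
next
  case (Cons l w)
  obtain i e where l: "l = (i, e)" by force
  obtain n :: int where n: "\<forall>x\<in>carrier G. word_eval G w (\<lambda>i. if i = k then x else \<one>) = x [^] n"
    using Cons by blast
  have "x [^] (1 + n) = x \<otimes> x [^] n" "x [^] (- 1 + n) = inv x \<otimes> x [^] n" if "x \<in> carrier G" for x
    using that int_pow_mult[of x 1 n] int_pow_mult[of x "-1" n] int_pow_neg[of x 1] by simp_all
  then have "\<forall>x\<in>carrier G. word_eval G (l # w) (\<lambda>i. if i = k then x else \<one>)
      = x [^] ((if i = k then if e then 1 else - 1 else 0) + n)"
    using n by (simp add: l)
  then show ?case by blast
qed

text \<open>A Bezout coefficient of \<open>n\<close> modulo the group order inverts the power map,
  even though that map need not be a homomorphism.\<close>

lemma int_pow_surj_if_coprime: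
  assumes "finite (carrier G)" "coprime n (int (order G))" "y \<in> carrier G"
  shows "\<exists>x\<in>carrier G. x [^] n = y"
proof -
  obtain s t where st: "s * n + t * int (order G) = 1"
    using bezout_int[of n "int (order G)"] assms(2) by (auto simp: coprime_iff_gcd_eq_1)
  have "y [^] (int (order G) * t) = \<one>"
    using assms(3) pow_order_eq_1[of y] by (simp add: int_pow_int flip: int_pow_pow)
  then have "(y [^] s) [^] n = y [^] (s * n) \<otimes> y [^] (t * int (order G))"
    using assms(3) by (simp add: int_pow_pow mult.commute)
  also have "\<dots> = y [^] (1::int)" using assms(3) by (simp only: st flip: int_pow_mult)
  finally show ?thesis using assms(3) by (intro bexI[of _ "y [^] s"]) auto
qed

end

context extraspecial
begin

text \<open>\<open>G/Z\<close> is abelian, so modulo \<open>Z\<close> the word map is multiplicative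
  on tuples, which can then be assembled one letter at a time.\<close>

lemma word_eval_mult_mod_Z:
  assumes a: "a \<in> {..<d} \<rightarrow> carrier G" and b: "b \<in> {..<d} \<rightarrow> carrier G" and "is_word d w"
  shows "\<exists>z\<in>Z. word_eval G w (\<lambda>i. a i \<otimes> b i) = z \<otimes> (word_eval G w a \<otimes> word_eval G w b)"
  using assms(3)
proof (induction w)
  case Nil
  show ?case by (intro bexI[of _ \<one>]) simp_all
next
  case (Cons l w)
  obtain i e where l: "l = (i, e)" by force
  have i [simp]: "a i \<in> carrier G" "b i \<in> carrier G" and w: "is_word d w"
    using Cons.prems a b l by (auto simp: is_word_def)
  obtain z where z: "z \<in> Z" "word_eval G w (\<lambda>i. a i \<otimes> b i) = z \<otimes> (word_eval G w a \<otimes> word_eval G w b)"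
    using Cons.IH[OF w] by blast
  define A B where "A = word_eval G w a" and "B = word_eval G w b"
  have [simp]: "A \<in> carrier G" "B \<in> carrier G"
    using word_eval_closed[OF w] a b by (simp_all add: A_def B_def)
  define a' b' where "a' = (if e then a i else inv (a i))" and "b' = (if e then b i else inv (b i))"
  have [simp]: "a' \<in> carrier G" "b' \<in> carrier G" by (simp_all add: a'_def b'_def)
  \<comment> \<open>Inverting a product reverses its factors; \<open>t\<close> pays for restoring
    the order.\<close>
  define t where "t = (if e then \<one> else cmt b' a')"
  have t: "t \<in> Z" by (simp add: t_def)
  have "(if e then a i \<otimes> b i else inv (a i \<otimes> b i)) = t \<otimes> (a' \<otimes> b')"
    using cmt_mult[of "inv (b i)" "inv (a i)"] by (simp add: t_def a'_def b'_def inv_mult_group)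
  then have "word_eval G (l # w) (\<lambda>i. a i \<otimes> b i) = t \<otimes> (a' \<otimes> b') \<otimes> (z \<otimes> (A \<otimes> B))"
    using z by (simp add: l A_def B_def)
  also have "\<dots> = t \<otimes> ((a' \<otimes> b') \<otimes> z) \<otimes> (A \<otimes> B)"
    using t z by (simp add: m_assoc)
  also have "(a' \<otimes> b') \<otimes> z = z \<otimes> (a' \<otimes> b')"
    using z Z_commute[of z "a' \<otimes> b'"] by simp
  also have "t \<otimes> (z \<otimes> (a' \<otimes> b')) \<otimes> (A \<otimes> B) = (t \<otimes> z) \<otimes> (a' \<otimes> (b' \<otimes> A) \<otimes> B)"
    using t z by (simp add: m_assoc)
  also have "b' \<otimes> A = cmt b' A \<otimes> (A \<otimes> b')"
    by (intro cmt_mult) simp_all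
  also have "a' \<otimes> (cmt b' A \<otimes> (A \<otimes> b')) = cmt b' A \<otimes> (a' \<otimes> (A \<otimes> b'))"
    using Z_commute[of "cmt b' A" a'] by (simp flip: m_assoc)
  also have "(t \<otimes> z) \<otimes> (cmt b' A \<otimes> (a' \<otimes> (A \<otimes> b')) \<otimes> B) = (t \<otimes> z \<otimes> cmt b' A) \<otimes> ((a' \<otimes> A) \<otimes> (b' \<otimes> B))"
    using t z by (simp add: m_assoc)
  finally have "word_eval G (l # w) (\<lambda>i. a i \<otimes> b i)
      = (t \<otimes> z \<otimes> cmt b' A) \<otimes> (word_eval G (l # w) a \<otimes> word_eval G (l # w) b)"
    by (simp add: l A_def B_def a'_def b'_def)
  then show ?case using t z by (intro bexI[of _ "t \<otimes> z \<otimes> cmt b' A"]) simp_all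
qed

text \<open>Substitutions in a single letter decide, and they are powers \<open>x^n\<close>. If all
  stay in \<open>Z\<close>, so does every value of the word. If one leaves \<open>Z\<close>, then
  \<open>n\<close> is prime to \<open>p\<close>, since \<open>x^p\<close> is central, and the power
  map is onto.\<close>

lemma word_image_cases:
  assumes w: "is_word d w"
  shows "word_image G d w \<subseteq> Z \<or> word_image G d w = carrier G"
proof (cases "\<forall>k<d. \<forall>x\<in>carrier G. word_eval G w (\<lambda>i. if i = k then x else \<one>) \<in> Z")
  case True
  have "word_eval G w g \<in> Z" if g: "g \<in> {..<d} \<rightarrow> carrier G" for g
  proof -
    \<comment> \<open>\<open>r m\<close> keeps the first \<open>m\<close> entries of
      \<open>g\<close> and is the identity elsewhere, so \<open>r d\<close> agrees with
      \<open>g\<close> on every letter that \<open>w\<close> can contain.\<close>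
    define r where "r m i = (if i < m \<and> i < d then g i else \<one>)" for m i
    have r: "r m \<in> {..<d} \<rightarrow> carrier G" for m using g by (auto simp: r_def)
    have "word_eval G w (r m) \<in> Z" for m
    proof (induction m)
      case 0
      then show ?case by (simp add: r_def word_eval_one)
    next
      case (Suc m)
      show ?case
      proof (cases "m < d")
        case True
        define s where "s i = (if i = m then g m else \<one>)" for i
        have s: "s \<in> {..<d} \<rightarrow> carrier G" using g True by (auto simp: s_def)
        have "r (Suc m) = (\<lambda>i. r m i \<otimes> s i)"
          using g True by (auto simp: r_def s_def fun_eq_iff Pi_iff less_Suc_eq)
        then obtain z where "z \<in> Z" "word_eval G w (r (Suc m)) = z \<otimes> (word_eval G w (r m) \<otimes> word_eval G w s)"
          using word_eval_mult_mod_Z[OF r s w] by metis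
        moreover have "word_eval G w s \<in> Z"
          unfolding s_def using True g \<open>\<forall>k<d. _\<close> by (auto simp: Pi_iff)
        ultimately show ?thesis using Suc by simp
      next
        case False
        then have "r (Suc m) = r m" by (auto simp: r_def fun_eq_iff)
        then show ?thesis using Suc by simp
      qed
    qed
    then have "word_eval G w (r d) \<in> Z" .
    moreover have "word_eval G w (r d) = word_eval G w g"
      using w by (induction w) (auto simp: r_def is_word_def)
    ultimately show ?thesis by simp
  qed
  then show ?thesis by (auto simp: word_image_def)
next
  case False
  then obtain k x where k: "k < d" "x \<in> carrier G" "word_eval G w (\<lambda>i. if i = k then x else \<one>) \<notin> Z" by blast
  obtain n :: int where n: "\<And>x. x \<in> carrier G \<Longrightarrow> word_eval G w (\<lambda>i. if i = k then x else \<one>) = x [^] n"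
    using word_eval_single_letter by blast
  have "\<not> int p dvd n"
  proof
    assume "int p dvd n"
    then obtain m where "n = int p * m" by blast
    then have "x [^] n = (x [^] p) [^] m"
      using k by (simp add: int_pow_int flip: int_pow_pow)
    then have "x [^] n \<in> Z"
      using subgroup_int_pow_closed[OF subgroup_Z] k by simp
    then show False using n k by simp
  qed
  then have "coprime n (int p)"
    using prime_p prime_imp_coprime[of "int p" n] by (simp add: coprime_commute)
  moreover obtain N where "order G = p ^ N" using order_prime_power by (auto simp: order_def)
  ultimately have cop: "coprime n (int (order G))" by simp
  have "carrier G \<subseteq> word_image G d w"
  proof
    fix y assume "y \<in> carrier G"
    then obtain v where v: "v \<in> carrier G" "v [^] n = y"
      using int_pow_surj_if_coprime[OF fin cop] by blast
    then have "y = word_eval G w (\<lambda>i. if i = k then v else \<one>)" using n by simp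
    moreover have "(\<lambda>i. if i = k then v else \<one>) \<in> {..<d} \<rightarrow> carrier G" using v by auto
    ultimately show "y \<in> word_image G d w" unfolding word_image_def by blast
  qed
  then show ?thesis
    using word_image_candidate_word_image[OF w] by (auto simp: word_image_candidate_def)
qed

lemma candidate_subset_Z:
  assumes A: "word_image_candidate G A" and "A \<subseteq> Z"
  shows "A = {\<one>} \<or> A = Z"
proof -
  have "\<one> \<in> A" using A by (simp add: word_image_candidate_def)
  moreover have "A = Z" if "v \<in> A" "v \<noteq> \<one>" for v
  proof -
    have "z \<in> A" if "z \<in> Z" for z
      using word_image_candidate_closed[OF A \<open>v \<in> A\<close>] aut_orbit_Z[of v z] \<open>v \<in> A\<close> \<open>v \<noteq> \<one>\<close> \<open>\<one> \<in> A\<close>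
        that assms(2) by blast
    then show ?thesis using assms(2) by blast
  qed
  ultimately show ?thesis by blast
qed

lemma word_image_iff:
  "(\<exists>d\<ge>1. \<exists>w. is_word d w \<and> A = word_image G d w) \<longleftrightarrow> A \<in> {{\<one>}, Z, carrier G}"
proof
  assume "\<exists>d\<ge>1. \<exists>w. is_word d w \<and> A = word_image G d w"
  then show "A \<in> {{\<one>}, Z, carrier G}"
    using word_image_cases candidate_subset_Z word_image_candidate_word_image by blast
next
  assume "A \<in> {{\<one>}, Z, carrier G}"
  then consider "A = {\<one>}" | "A = Z" | "A = carrier G" by blast
  then show "\<exists>d\<ge>1. \<exists>w. is_word d w \<and> A = word_image G d w"
  proof cases
    case 1
    have "word_image G 1 [] = {\<one>}" by (auto simp: word_image_def)
    moreover have "is_word 1 []" by (simp add: is_word_def)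
    ultimately show ?thesis using 1 by (metis le_refl)
  next
    case 2
    define w where "w = [(0::nat, True), (1, True), (0, False), (1, False)]"
    have w: "is_word 2 w" by (simp add: is_word_def w_def)
    have eval: "word_eval G w g = cmt (g 0) (g 1)" if "g \<in> {..<2} \<rightarrow> carrier G" for g
      using that by (auto simp: w_def cmt_def m_assoc Pi_iff)
    then have sub: "word_image G 2 w \<subseteq> Z" by (auto simp: word_image_def Pi_iff)
    obtain x where x: "x \<in> carrier G" "x \<notin> Z" using Z_neq_carrier Z_closed by blast
    then obtain u where u: "u \<in> carrier G" "cmt x u \<noteq> \<one>" using noncentral_cmt by blast
    define g where "g i = (if i = (0::nat) then x else u)" for i
    have "g \<in> {..<2} \<rightarrow> carrier G" using x u by (simp add: g_def)
    then have "cmt x u \<in> word_image G 2 w"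
      unfolding word_image_def using eval[of g] by (intro CollectI exI[of _ g]) (simp add: g_def)
    \<comment> \<open>One nontrivial commutator is enough: the image is a candidate inside
      \<open>Z\<close>, and \<open>Z - {1}\<close> is a single orbit.\<close>
    then have "word_image G 2 w = Z"
      using candidate_subset_Z[OF word_image_candidate_word_image[OF w] sub] u by auto
    then show ?thesis using 2 w by (metis one_le_numeral)
  next
    case 3
    have "carrier G \<subseteq> word_image G 1 [(0, True)]"
    proof
      fix x assume "x \<in> carrier G"
      then show "x \<in> word_image G 1 [(0, True)]"
        unfolding word_image_def by (intro CollectI exI[of _ "\<lambda>_. x"]) simp
    qed
    moreover have w: "is_word 1 [(0, True)]" by (simp add: is_word_def)
    then have "word_image G 1 [(0, True)] \<subseteq> carrier G"
      using word_image_candidate_word_image by (simp add: word_image_candidate_def)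
    ultimately show ?thesis using 3 w by (metis le_refl subset_antisym)
  qed
qed

text \<open>\<open>f\<close> has to be a complete invariant of automorphism orbits. The truncated
  subtraction is harmless, since the three distinct word images are themselves candidates.\<close>

lemma num_impostors_eq:
  assumes "\<And>\<phi> x. \<lbrakk>\<phi> \<in> iso G G; x \<in> carrier G\<rbrakk> \<Longrightarrow> f (\<phi> x) = f x"
    and "\<And>x y. \<lbrakk>x \<in> carrier G; y \<in> carrier G; f x = f y\<rbrakk> \<Longrightarrow> aut_orbit x y"
  shows "num_impostors G = 2 ^ (card (f ` carrier G) - 1) - 3"
proof -
  let ?W = "{{\<one>}, Z, carrier G}"
  have "?W \<subseteq> {A. word_image_candidate G A}"
  proof
    fix A assume "A \<in> ?W"
    then obtain d w where "is_word d w" "A = word_image G d w"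
      using word_image_iff[of A] by blast
    then show "A \<in> {A. word_image_candidate G A}"
      using word_image_candidate_word_image by simp
  qed
  moreover have "card ?W = 3"
  proof -
    have Z1: "{\<one>} \<noteq> Z"
    proof
      assume "{\<one>} = Z"
      then have "card Z = card {\<one>}" by (rule arg_cong[OF sym])
      then show False using card_Z p_gt_1 by simp
    qed
    moreover have "{\<one>} \<noteq> carrier G"
    proof
      assume "{\<one>} = carrier G"
      then have "Z \<subseteq> {\<one>}" using Z_closed by blast
      then show False using Z1 one_in_Z by blast
    qed
    ultimately show ?thesis using Z_neq_carrier by simp
  qed
  moreover have "{A. word_image_impostor G A} = {A. word_image_candidate G A} - ?W"
    unfolding word_image_impostor_def word_image_iff by blast
  moreover have "card {A. word_image_candidate G A} = 2 ^ (card (f ` carrier G) - 1)"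
    using fin assms by (rule card_word_image_candidates)
  ultimately show ?thesis
    unfolding num_impostors_def by (simp add: card_Diff_subset)
qed

end

section \<open>Odd primes\<close>

context extraspecial
begin

lemma Z_powers_inj:
  assumes z: "z \<in> Z" "z \<noteq> \<one>" and "z [^] m = z [^] n" "m < p" "n < (p::nat)"
  shows "m = n"
proof -
  have "inj_on (\<lambda>n. z [^] n) {0..ord z - 1}"
    using z by (intro ord_inj) simp
  then show ?thesis
    using assms p_gt_1 ord_Z[OF z] by (auto dest: inj_onD[of _ _ m n])
qed

lemma iso_self_pow_p_eq_one:
  assumes "\<phi> \<in> iso G G" "x \<in> carrier G"
  shows "\<phi> x [^] p = \<one> \<longleftrightarrow> x [^] p = \<one>"
  using assms iso_self_eq_iff[OF assms(1), of "x [^] p" \<one>] by (simp add: iso_self_pow iso_self_one)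

lemma iso_self_eq_one: "\<lbrakk>\<phi> \<in> iso G G; x \<in> carrier G\<rbrakk> \<Longrightarrow> \<phi> x = \<one> \<longleftrightarrow> x = \<one>"
  using iso_self_eq_iff[of \<phi> x \<one>] by (simp add: iso_self_one)

lemma aut_orbit_in_Z:
  assumes "x \<in> Z" "y \<in> Z" "x = \<one> \<longleftrightarrow> y = \<one>"
  shows "aut_orbit x y"
  using assms aut_orbit_Z[of x y] aut_orbit_refl by (cases "x = \<one>") auto

lemma subgroup_pow_p_trivial:
  assumes "odd p"
  shows "subgroup {x \<in> carrier G. x [^] p = \<one>} G"
  using assms by (intro finite_subgroupI) (auto simp: pow_p_mult_odd)

text \<open>An intermediate element must also have trivial \<open>p\<close>-th power. For odd
  \<open>p\<close> such elements form a subgroup, and \<open>u\<close>, \<open>v\<close> show that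
  neither centraliser contains it.\<close>

lemma aut_orbit_order_p:
  assumes p: "odd p" and x: "x \<in> carrier G" "x [^] p = \<one>" and y: "y \<in> carrier G" "y [^] p = \<one>"
    and u: "u \<in> carrier G" "u [^] p = \<one>" "cmt x u \<noteq> \<one>"
    and v: "v \<in> carrier G" "v [^] p = \<one>" "cmt y v \<noteq> \<one>"
  shows "aut_orbit x y"
proof (cases "cmt x y = \<one>")
  case True
  obtain w where "w \<in> carrier G" "w [^] p = \<one>" "cmt x w \<noteq> \<one>" "cmt y w \<noteq> \<one>"
    using ex_noncommuting_both[OF subgroup_pow_p_trivial[OF p], of x y u v] assms by blast
  then show ?thesis using aut_orbit_via[of x y w] x y by simp
next
  case False
  then show ?thesis using aut_orbit_noncommuting[of x y] x y by simp
qed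

text \<open>The \<open>p\<close>-th power map is a homomorphism into \<open>Z\<close>, onto because
  \<open>x^p\<close> generates \<open>Z\<close>; the powers of \<open>x\<close> represent the cosets
  of its kernel.\<close>

lemma ex_order_p_multiple:
  assumes p: "odd p" and x: "x \<in> carrier G" "x [^] p \<noteq> \<one>" and g: "g \<in> carrier G"
  shows "\<exists>h\<in>carrier G. \<exists>n<p. h [^] p = \<one> \<and> g = h \<otimes> x [^] (n::nat)"
proof -
  obtain n :: nat where n: "n < p" "g [^] p = (x [^] p) [^] n"
    using Z_powers[of "x [^] p" "g [^] p"] x g by auto
  define h where "h = g \<otimes> inv (x [^] n)"
  have h: "h \<in> carrier G" and gh: "g = h \<otimes> x [^] n"
    using x g by (simp_all add: h_def m_assoc)
  have "g [^] p = h [^] p \<otimes> (x [^] n) [^] p"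
    unfolding gh using h x p by (intro pow_p_mult_odd) simp_all
  then have "h [^] p \<otimes> (x [^] p) [^] n = (x [^] p) [^] n"
    using n x by (simp add: nat_pow_pow mult.commute)
  then have "h [^] p = \<one>"
    using h x r_cancel_one[of "(x [^] p) [^] n" "h [^] p"] l_cancel_one[of "(x [^] p) [^] n" "h [^] p"] by simp
  then show ?thesis using h gh n by blast
qed

lemma aut_orbit_order_p2:
  assumes p: "odd p" and x: "x \<in> carrier G" "x [^] p \<noteq> \<one>" and y: "y \<in> carrier G" "y [^] p \<noteq> \<one>"
  shows "aut_orbit x y"
proof -
  have witness: "\<exists>u\<in>carrier G. u [^] p = \<one> \<and> cmt v u \<noteq> \<one>" if v: "v \<in> carrier G" "v [^] p \<noteq> \<one>" for v
  proof -
    have "v \<notin> Z" using v by auto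
    then obtain g where g: "g \<in> carrier G" "cmt v g \<noteq> \<one>" using noncentral_cmt v by blast
    then obtain h and n :: nat where h: "h \<in> carrier G" "h [^] p = \<one>" "g = h \<otimes> v [^] n"
      using ex_order_p_multiple[OF p v] by blast
    then have "cmt v g = cmt v h" using v by (simp add: cmt_mult_right cmt_pow_right)
    then show ?thesis using g h by auto
  qed
  \<comment> \<open>An automorphism moving central elements first aligns the \<open>p\<close>-th
    powers, as transvections require.\<close>
  obtain \<phi> where \<phi>: "\<phi> \<in> iso G G" "\<phi> (x [^] p) = y [^] p"
    using aut_orbit_Z[of "x [^] p" "y [^] p"] x y unfolding aut_orbit_def by auto
  define x' where "x' = \<phi> x"
  have x' [simp]: "x' \<in> carrier G" using \<phi> x by (simp add: x'_def iso_self_closed)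
  have pow: "x' [^] p = y [^] p" using \<phi> x by (simp add: x'_def iso_self_pow)
  have "aut_orbit x' y"
  proof (cases "cmt x' y = \<one>")
    case True
    then have yx: "cmt y x' = \<one>" using y cmt_eq_one_commute[of x' y] by simp
    obtain u where "u \<in> carrier G" "u [^] p = \<one>" "cmt x' u \<noteq> \<one>"
      using witness[of x'] y pow by auto
    moreover obtain v where "v \<in> carrier G" "v [^] p = \<one>" "cmt y v \<noteq> \<one>"
      using witness[of y] y by auto
    ultimately obtain w where w: "w \<in> carrier G" "w [^] p = \<one>" "cmt x' w \<noteq> \<one>" "cmt y w \<noteq> \<one>"
      using ex_noncommuting_both[OF subgroup_pow_p_trivial[OF p], of x' y u v] y by auto
    \<comment> \<open>Since \<open>w^p = 1\<close>, the element \<open>x' w\<close> keeps the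
      \<open>p\<close>-th power of \<open>x'\<close>, while commuting with neither \<open>x'\<close>
      nor \<open>y\<close>.\<close>
    have "(x' \<otimes> w) [^] p = x' [^] p" using p w by (simp add: pow_p_mult_odd)
    moreover have "cmt x' (x' \<otimes> w) \<noteq> \<one>" using w by (simp add: cmt_mult_right)
    moreover have "cmt y (x' \<otimes> w) \<noteq> \<one>" using w y yx by (simp add: cmt_mult_right)
    ultimately show ?thesis
      using w y pow by (intro aut_orbit_via[of x' y "x' \<otimes> w"]) simp_all
  next
    case False
    then show ?thesis using aut_orbit_noncommuting[of x' y] y pow by simp
  qed
  moreover have "aut_orbit x x'" using \<phi> unfolding aut_orbit_def x'_def by blast
  ultimately show ?thesis using aut_orbit_trans by blast
qed

lemma ex_noncentral: "\<exists>x\<in>carrier G. x \<notin> Z"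
  using Z_neq_carrier Z_closed by blast

lemma ex_nontrivial_Z: "\<exists>z\<in>Z. z \<noteq> \<one>"
  using ex_noncentral noncentral_cmt cmt_in_Z by metis

lemma num_impostors_exponent_p:
  assumes p: "odd p" and exp: "\<And>x. x \<in> carrier G \<Longrightarrow> x [^] p = \<one>"
  shows "num_impostors G = 1"
proof -
  define f where "f x = (x \<in> Z, x = \<one>)" for x
  have "num_impostors G = 2 ^ (card (f ` carrier G) - 1) - 3"
  proof (rule num_impostors_eq)
    fix x y assume xy: "x \<in> carrier G" "y \<in> carrier G" "f x = f y"
    show "aut_orbit x y"
    proof (cases "x \<in> Z")
      case True
      then show ?thesis using xy by (intro aut_orbit_in_Z) (auto simp: f_def)
    next
      case False
      then have "y \<notin> Z" using xy by (simp add: f_def)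
      then show ?thesis
        using False xy noncentral_cmt[of x] noncentral_cmt[of y] aut_orbit_order_p[OF p] exp by metis
    qed
  qed (simp add: f_def iso_self_center iso_self_eq_one)
  moreover have "f ` carrier G = {(True, True), (True, False), (False, False)}"
  proof -
    obtain z where z: "z \<in> Z" "z \<noteq> \<one>" using ex_nontrivial_Z by blast
    obtain x where x: "x \<in> carrier G" "x \<notin> Z" using ex_noncentral by blast
    have "f \<one> = (True, True)" "f z = (True, False)" "f x = (False, False)"
      using z x by (auto simp: f_def)
    then have "{(True, True), (True, False), (False, False)} \<subseteq> f ` carrier G"
      using z x by (metis Z_closed empty_subsetI image_eqI insert_subset one_closed)
    moreover have "f ` carrier G \<subseteq> {(True, True), (True, False), (False, False)}"
      by (auto simp: f_def)
    ultimately show ?thesis by blast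
  qed
  ultimately show ?thesis by simp
qed

text \<open>The power map \<open>x \<mapsto> x\<^sup>p\<close> is \<open>[\<cdot>, u]\<close> for some \<open>u\<close>; \<open>ratios x = {c}\<close> says that \<open>x\<close> lies
  in the coset \<open>u\<^sup>c Z\<close>, in a form which automorphisms visibly preserve.\<close>

definition ratios :: "'a \<Rightarrow> nat set" where
  "ratios x = {c. c < p \<and> (\<forall>g\<in>carrier G. cmt g x = (g [^] p) [^] c)}"

lemma iso_self_ratios:
  assumes \<phi>: "\<phi> \<in> iso G G" and x: "x \<in> carrier G"
  shows "ratios (\<phi> x) = ratios x"
proof -
  have "(\<forall>g\<in>carrier G. cmt g (\<phi> x) = (g [^] p) [^] c) \<longleftrightarrow>
      (\<forall>g\<in>carrier G. cmt g x = (g [^] p) [^] c)" for c :: nat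
  proof -
    have "(\<forall>g\<in>carrier G. cmt g (\<phi> x) = (g [^] p) [^] c) \<longleftrightarrow>
        (\<forall>g\<in>carrier G. cmt (\<phi> g) (\<phi> x) = (\<phi> g [^] p) [^] c)"
      by (subst iso_self_image[OF \<phi>, symmetric]) simp
    also have "\<dots> \<longleftrightarrow> (\<forall>g\<in>carrier G. \<phi> (cmt g x) = \<phi> ((g [^] p) [^] c))"
      using \<phi> x by (simp add: iso_self_cmt iso_self_pow)
    also have "\<dots> \<longleftrightarrow> (\<forall>g\<in>carrier G. cmt g x = (g [^] p) [^] c)"
      using \<phi> x iso_self_eq_iff[OF \<phi>] by simp
    finally show ?thesis .
  qed
  then show ?thesis by (simp add: ratios_def)
qed

lemma zero_in_ratios_iff: "x \<in> carrier G \<Longrightarrow> 0 \<in> ratios x \<longleftrightarrow> x \<in> Z"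
  using p_gt_1 unfolding ratios_def mem_group_center_iff by auto

lemma ratios_coset:
  assumes "c \<in> ratios x" "c \<in> ratios y" "x \<in> carrier G" "y \<in> carrier G"
  shows "y \<otimes> inv x \<in> Z"
proof -
  have "cmt g (y \<otimes> inv x) = \<one>" if "g \<in> carrier G" for g
  proof -
    have "cmt g y = cmt g x" using assms that by (simp add: ratios_def)
    then show ?thesis
      using assms that by (simp add: cmt_mult_right cmt_inv_right cmt_inv[of g x, symmetric])
  qed
  then show ?thesis using assms unfolding mem_group_center_iff by simp
qed

text \<open>At \<open>g = x\<close> the defining equation reads \<open>1 = (x^p)^c\<close>. A
  nontrivial \<open>x^p\<close> would give \<open>c = 0\<close>, so \<open>x\<close> would be
  central and \<open>x^p\<close> trivial after all.\<close>

lemma ratios_pow_p: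
  assumes "c \<in> ratios x" "x \<in> carrier G"
  shows "x [^] p = \<one>"
proof (rule ccontr)
  assume 1: "x [^] p \<noteq> \<one>"
  have "(x [^] p) [^] c = \<one>" using assms by (auto simp: ratios_def dest!: bspec[of _ _ x])
  then have "p dvd c" using Z_pow_eq_one_iff[of "x [^] p" c] 1 assms by simp
  then have "c = 0" using assms by (auto simp: ratios_def dest: dvd_imp_le)
  then have "x \<in> Z" using assms zero_in_ratios_iff by simp
  then show False using 1 by simp
qed

lemma ratios_mult_Z:
  assumes "x \<in> carrier G" "s \<in> Z"
  shows "ratios (s \<otimes> x) = ratios x"
  using assms by (auto simp: ratios_def cmt_mult_right)

section \<open>Orbit count for odd \<open>p\<close> when some \<open>p\<close>-th power is
  nontrivial\<close>

context
  fixes g0 u :: 'a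
  assumes p: "odd p"
    and g0: "g0 \<in> carrier G" "g0 [^] p \<noteq> \<one>"
    and u: "u \<in> carrier G" "\<And>g. g \<in> carrier G \<Longrightarrow> cmt g u = g [^] p"
begin

lemma ratios_unique:
  assumes "c \<in> ratios x" shows "ratios x = {c}"
proof -
  have "d = c" if "d \<in> ratios x" for d
  proof (rule Z_powers_inj)
    have "(g0 [^] p) [^] d = cmt g0 x" using that g0 by (simp add: ratios_def)
    also have "\<dots> = (g0 [^] p) [^] c" using assms g0 by (simp add: ratios_def)
    finally show "(g0 [^] p) [^] d = (g0 [^] p) [^] c" .
  qed (use assms that g0 in \<open>simp_all add: ratios_def\<close>)
  then show ?thesis using assms by blast
qed

lemma ratios_pow_u: "c < p \<Longrightarrow> ratios (u [^] c) = {c}"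
  using u by (intro ratios_unique) (simp add: ratios_def cmt_pow_right)

text \<open>A homomorphism into \<open>Z\<close> that vanishes on the kernel of the
  \<open>p\<close>-th power map is a multiple of it; the factor is read off at
  \<open>g0\<close>.\<close>

lemma ratios_nonempty_if_commutes:
  assumes x: "x \<in> carrier G" and "\<And>h. \<lbrakk>h \<in> carrier G; h [^] p = \<one>\<rbrakk> \<Longrightarrow> cmt h x = \<one>"
  shows "ratios x \<noteq> {}"
proof -
  obtain c :: nat where c: "c < p" "cmt g0 x = (g0 [^] p) [^] c"
    using Z_powers[of "g0 [^] p" "cmt g0 x"] g0 x by auto
  have "cmt g x = (g [^] p) [^] c" if g: "g \<in> carrier G" for g
  proof -
    obtain h and n :: nat where h: "h \<in> carrier G" "h [^] p = \<one>" "g = h \<otimes> g0 [^] n"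
      using ex_order_p_multiple[OF p g0 g] by blast
    have "cmt g x = (g0 [^] p) [^] (c * n)"
      using h g0 x assms(2)[of h] by (simp add: cmt_mult_left cmt_pow_left c nat_pow_pow mult.assoc)
    moreover have "g [^] p = (g0 [^] p) [^] n"
      using h g0 p by (simp add: pow_p_mult_odd nat_pow_pow mult.commute)
    ultimately show ?thesis using g0 by (simp add: nat_pow_pow mult.commute mult.left_commute)
  qed
  then have "c \<in> ratios x" using c by (simp add: ratios_def)
  then show ?thesis by blast
qed

text \<open>The set is the disjoint union of the \<open>p\<close> cosets \<open>u^c Z\<close>,
  central elements included as \<open>c = 0\<close>.\<close>

lemma card_ratios_nonempty: "card {x \<in> carrier G. ratios x \<noteq> {}} = p ^ 2"
proof -
  have "bij_betw (\<lambda>(c, s). s \<otimes> u [^] c) ({..<p} \<times> Z) {x \<in> carrier G. ratios x \<noteq> {}}"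
    unfolding bij_betw_def
  proof (intro conjI subset_antisym subsetI)
    show "inj_on (\<lambda>(c, s). s \<otimes> u [^] c) ({..<p} \<times> Z)"
    proof (intro inj_onI; clarify)
      fix c s d t assume *: "s \<in> Z" "t \<in> Z" "c < p" "d < p" and eq: "s \<otimes> u [^] c = t \<otimes> u [^] d"
      have "ratios (u [^] c) = ratios (s \<otimes> u [^] c)" using * u(1) by (simp add: ratios_mult_Z)
      also have "\<dots> = ratios (u [^] d)" unfolding eq using * u(1) by (simp add: ratios_mult_Z)
      finally have "c = d" using * by (simp add: ratios_pow_u)
      then show "c = d \<and> s = t" using * u(1) eq by simp
    qed
    show "x \<in> {x \<in> carrier G. ratios x \<noteq> {}}"
      if "x \<in> (\<lambda>(c, s). s \<otimes> u [^] c) ` ({..<p} \<times> Z)" for x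
      using that u by (auto simp: ratios_mult_Z ratios_pow_u)
    show "x \<in> (\<lambda>(c, s). s \<otimes> u [^] c) ` ({..<p} \<times> Z)"
      if x: "x \<in> {x \<in> carrier G. ratios x \<noteq> {}}" for x
    proof -
      obtain c where c: "c \<in> ratios x" and x: "x \<in> carrier G" using x by blast
      then have cp: "c < p" by (simp add: ratios_def)
      then have "x \<otimes> inv (u [^] c) \<in> Z"
        using ratios_coset[of c "u [^] c" x] c x u ratios_pow_u by simp
      moreover have "x = (x \<otimes> inv (u [^] c)) \<otimes> u [^] c" using x u by (simp add: m_assoc)
      ultimately show ?thesis using cp by (intro image_eqI[of _ _ "(c, x \<otimes> inv (u [^] c))"]) auto
    qed
  qed
  then have "card ({..<p} \<times> Z) = card {x \<in> carrier G. ratios x \<noteq> {}}"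
    by (rule bij_betw_same_card)
  then show ?thesis by (simp add: card_cartesian_product card_Z power2_eq_square)
qed

lemma order_eq_mult_card: "order G = p * card {x \<in> carrier G. x [^] p = \<one>}"
proof -
  let ?\<Omega> = "{x \<in> carrier G. x [^] p = \<one>}"
  have "bij_betw (\<lambda>(n, h). h \<otimes> g0 [^] n) ({..<p} \<times> ?\<Omega>) (carrier G)"
    unfolding bij_betw_def
  proof (intro conjI subset_antisym subsetI)
    show "inj_on (\<lambda>(n, h). h \<otimes> g0 [^] n) ({..<p} \<times> ?\<Omega>)"
    proof (intro inj_onI; clarify)
      fix m n :: nat and h k assume *: "h \<in> carrier G" "h [^] p = \<one>" "k \<in> carrier G" "k [^] p = \<one>"
        "m < p" "n < p" and eq: "h \<otimes> g0 [^] m = k \<otimes> g0 [^] n"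
      have "(g0 [^] m) [^] p = (h \<otimes> g0 [^] m) [^] p"
        using * g0 p by (simp add: pow_p_mult_odd)
      also have "\<dots> = (g0 [^] n) [^] p"
        unfolding eq using * g0 p by (simp add: pow_p_mult_odd)
      finally have "(g0 [^] p) [^] m = (g0 [^] p) [^] n"
        using g0 by (simp add: nat_pow_pow mult.commute)
      then have "m = n" using Z_powers_inj[of "g0 [^] p" m n] g0 * by simp
      then show "m = n \<and> h = k" using * g0 eq by simp
    qed
    show "x \<in> carrier G" if "x \<in> (\<lambda>(n, h). h \<otimes> g0 [^] n) ` ({..<p} \<times> ?\<Omega>)" for x
      using that g0 by auto
    show "x \<in> (\<lambda>(n, h). h \<otimes> g0 [^] n) ` ({..<p} \<times> ?\<Omega>)" if x: "x \<in> carrier G" for x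
    proof -
      obtain h and n :: nat where "h \<in> carrier G" "h [^] p = \<one>" "n < p" "x = h \<otimes> g0 [^] n"
        using ex_order_p_multiple[OF p g0 x] by blast
      then show ?thesis by (intro image_eqI[of _ _ "(n, h)"]) auto
    qed
  qed
  then have "card ({..<p} \<times> ?\<Omega>) = card (carrier G)" by (rule bij_betw_same_card)
  then show ?thesis by (simp add: card_cartesian_product order_def)
qed

text \<open>The cosets \<open>u^c Z\<close> fill \<open>p^2\<close> places in the kernel of the
  \<open>p\<close>-th power map, which has index \<open>p\<close>; room is left over exactly when
  the order exceeds \<open>p^3\<close>.\<close>

lemma ratios_empty_iff_order:
  "(\<exists>x\<in>carrier G. x [^] p = \<one> \<and> ratios x = {}) \<longleftrightarrow> order G > p ^ 3"
proof -
  let ?\<Omega> = "{x \<in> carrier G. x [^] p = \<one>}" and ?R = "{x \<in> carrier G. ratios x \<noteq> {}}"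
  have sub: "?R \<subseteq> ?\<Omega>" using ratios_pow_p by blast
  have "p ^ 3 = p * p ^ 2" by (simp add: power3_eq_cube power2_eq_square)
  then have "order G > p ^ 3 \<longleftrightarrow> card ?R < card ?\<Omega>"
    using p_gt_1 by (simp add: order_eq_mult_card card_ratios_nonempty \<open>p ^ 3 = p * p ^ 2\<close>)
  also have "\<dots> \<longleftrightarrow> ?R \<noteq> ?\<Omega>"
    using sub psubset_card_mono[of ?\<Omega> ?R] by auto
  also have "\<dots> \<longleftrightarrow> (\<exists>x\<in>carrier G. x [^] p = \<one> \<and> ratios x = {})"
    using sub by blast
  finally show ?thesis by simp
qed

text \<open>The values of the invariant: one for the identity, one for order \<open>p^2\<close>,
  \<open>p\<close> for the cosets \<open>u^c Z\<close> (where \<open>c = 0\<close> means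
  \<open>Z - {1}\<close>), and one more for the remaining elements of order \<open>p\<close>, if
  any.\<close>

lemma num_impostors_if_power_is_cmt:
  "num_impostors G = 2 ^ (if order G > p ^ 3 then p + 2 else p + 1) - 3"
proof -
  define f where "f x = (ratios x, x = \<one>, x [^] p = \<one>)" for x
  have "num_impostors G = 2 ^ (card (f ` carrier G) - 1) - 3"
  proof (rule num_impostors_eq)
    fix x y assume xy: "x \<in> carrier G" "y \<in> carrier G" and f: "f x = f y"
    show "aut_orbit x y"
    proof (cases "x [^] p = \<one>")
      case False
      then show ?thesis using xy f aut_orbit_order_p2[OF p] by (simp add: f_def)
    next
      case True
      then have yp: "y [^] p = \<one>" using f by (simp add: f_def)
      show ?thesis
      proof (cases "ratios x = {}")
        case empty: True
        have witness: "\<exists>h\<in>carrier G. h [^] p = \<one> \<and> cmt v h \<noteq> \<one>" if "v \<in> carrier G" "ratios v = {}" for v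
          using ratios_nonempty_if_commutes[of v] that cmt_eq_one_commute by blast
        have "ratios y = {}" using empty f by (simp add: f_def)
        then show ?thesis
          using witness[of x] witness[of y] empty xy True yp aut_orbit_order_p[OF p, of x y] by blast
      next
        case False
        then obtain c where c: "c \<in> ratios x" by blast
        then have cy: "c \<in> ratios y" using f by (simp add: f_def)
        show ?thesis
        proof (cases "x \<in> Z")
          case xZ: True
          then have "y \<in> Z" using xy f zero_in_ratios_iff[of x] zero_in_ratios_iff[of y] by (simp add: f_def)
          then show ?thesis using xZ f by (intro aut_orbit_in_Z) (auto simp: f_def)
        next
          case False
          have "y = (y \<otimes> inv x) \<otimes> x" using xy by (simp add: m_assoc)
          then show ?thesis
            using aut_orbit_coset[OF xy(1) False ratios_coset[OF c cy xy]] by simp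
        qed
      qed
    qed
  qed (simp add: f_def iso_self_ratios iso_self_eq_one iso_self_pow_p_eq_one)
  moreover have "card (f ` carrier G) = (if order G > p ^ 3 then p + 3 else p + 2)"
  proof -
    define E where "E = (if order G > p ^ 3 then {({}::nat set, False, True)} else {})"
    let ?C = "(\<lambda>c. ({c}, False, True)) ` {..<p}"
    let ?K = "insert ({0}, True, True) (insert ({}, False, False) (?C \<union> E))"
    have f1: "f \<one> = ({0}, True, True)"
      using ratios_unique[of 0 \<one>] zero_in_ratios_iff[of \<one>] by (simp add: f_def)
    have fg0: "f g0 = ({}, False, False)"
      using g0 ratios_pow_p[of _ g0] by (auto simp: f_def)
    have "f ` carrier G = ?K"
    proof (intro subset_antisym subsetI)
      fix k assume "k \<in> f ` carrier G"
      then obtain x where x: "x \<in> carrier G" "k = f x" by blast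
      show "k \<in> ?K"
      proof (cases "ratios x = {}")
        case True
        then have "x \<noteq> \<one>" using f1 by (auto simp: f_def)
        then show ?thesis
          using True x ratios_empty_iff_order by (cases "x [^] p = \<one>") (auto simp: f_def E_def)
      next
        case False
        then obtain c where c: "c \<in> ratios x" by blast
        then have "ratios x = {c}" by (rule ratios_unique)
        moreover have "c < p" using c by (simp add: ratios_def)
        moreover have "x [^] p = \<one>" using c x(1) by (rule ratios_pow_p)
        ultimately show ?thesis using x f1 by (cases "x = \<one>") (auto simp: f_def)
      qed
    next
      fix k assume "k \<in> ?K"
      then consider "k = ({0}, True, True)" | "k = ({}, False, False)" | "k \<in> ?C" | "k \<in> E" by blast
      then show "k \<in> f ` carrier G"
      proof cases
        case 1
        then show ?thesis using f1 by (metis image_eqI one_closed)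
      next
        case 2
        then show ?thesis using fg0 g0 by (metis image_eqI)
      next
        case 3
        then obtain c where c: "c < p" "k = ({c}, False, True)" by blast
        show ?thesis
        \<comment> \<open>\<open>u^0\<close> is the identity, which has its own value, so
          \<open>c = 0\<close> needs a nontrivial central element instead.\<close>
        proof (cases "c = 0")
          case True
          obtain z where z: "z \<in> Z" "z \<noteq> \<one>" using ex_nontrivial_Z by blast
          then have "f z = k"
            using ratios_unique[of 0 z] zero_in_ratios_iff[of z] c True by (simp add: f_def)
          then show ?thesis using z by (metis Z_closed image_eqI)
        next
          case False
          have "u [^] c \<noteq> \<one>"
            using ratios_pow_u[OF c(1)] f1 False by (auto simp: f_def)
          then have "f (u [^] c) = k"
            using ratios_pow_u[OF c(1)] ratios_pow_p[of c "u [^] c"] u c by (simp add: f_def)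
          then show ?thesis using u by (metis nat_pow_closed image_eqI)
        qed
      next
        case 4
        then have k: "k = ({}, False, True)" and "order G > p ^ 3"
          by (auto simp: E_def split: if_splits)
        then obtain x where "x \<in> carrier G" "x [^] p = \<one>" "ratios x = {}"
          using ratios_empty_iff_order by blast
        moreover from this have "x \<noteq> \<one>" using f1 by (auto simp: f_def)
        ultimately have "f x = k" by (simp add: f_def k)
        then show ?thesis using \<open>x \<in> carrier G\<close> by blast
      qed
    qed
    moreover have "card ?C = p" by (simp add: card_image inj_on_def)
    moreover have "card (?C \<union> E) = card ?C + card E"
      by (intro card_Un_disjoint) (auto simp: E_def)
    moreover have "card ?K = 2 + card (?C \<union> E)"
      by (subst card_insert_disjoint; auto simp: E_def)+
    ultimately show ?thesis by (simp add: E_def)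
  qed
  ultimately show ?thesis by (simp split: if_splits)
qed

end

lemma num_impostors_exponent_p2:
  assumes p: "odd p" and "g \<in> carrier G" "g [^] p \<noteq> \<one>"
  shows "num_impostors G = 2 ^ (if order G > p ^ 3 then p + 2 else p + 1) - 3"
proof -
  have "\<exists>u\<in>carrier G. \<forall>g\<in>carrier G. cmt g u = g [^] p"
    using p by (intro hom_to_Z_is_commutator nondegenerate_carrier) (simp_all add: pow_p_mult_odd)
  then show ?thesis using num_impostors_if_power_is_cmt[OF assms] by blast
qed

end

section \<open>The prime 2\<close>

context extraspecial
begin

lemma two_cases_Z:
  assumes "p = 2" "z \<in> Z" "z \<noteq> \<one>" "s \<in> Z"
  shows "s = \<one> \<or> s = z"
  using Z_powers[OF assms(2-4)] assms(1,2) by (auto simp: less_2_cases_iff)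

lemma mult_square_p2:
  assumes "p = 2" "x \<in> carrier G" "y \<in> carrier G"
  shows "(x \<otimes> y) [^] p = x [^] p \<otimes> y [^] p \<otimes> cmt y x"
  using assms pow_mult_cmt[of x y 2] by simp

lemma aut_orbit_p2:
  assumes p: "p = 2" and x: "x \<in> carrier G" "x \<notin> Z" and y: "y \<in> carrier G" "y \<notin> Z"
    and sq: "x [^] p = y [^] p"
  shows "aut_orbit x y"
proof (cases "cmt x y = \<one>")
  case False
  then show ?thesis using aut_orbit_noncommuting[of x y] x y sq by blast
next
  case True
  then have yx: "cmt y x = \<one>" using x y cmt_eq_one_commute[of x y] by simp
  obtain a where a: "a \<in> carrier G" "cmt x a \<noteq> \<one>" using noncentral_cmt x by blast
  obtain b where b: "b \<in> carrier G" "cmt y b \<noteq> \<one>" using noncentral_cmt y by blast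
  obtain w where w: "w \<in> carrier G" "cmt x w \<noteq> \<one>" "cmt y w \<noteq> \<one>"
    using ex_noncommuting_both[OF subgroup_self x(1) y(1) a b] by blast
  have xw: "cmt x w \<in> Z" using x w by simp
  note two = two_cases_Z[OF p xw w(2)]
  show ?thesis
  proof (cases "w [^] p = x [^] p")
    case True
    then show ?thesis using aut_orbit_via[of x y w] x y w sq by metis
  next
    case w_neq: False
    show ?thesis
    proof (cases "x [^] p = \<one>")
      case True
      \<comment> \<open>Here \<open>(w x)^2 = w^2 x^2 [x, w] = 1\<close>, so \<open>w x\<close> can
        replace \<open>w\<close>; as \<open>x\<close> commutes with \<open>x\<close> and
        \<open>y\<close>, the commutators with them stay nontrivial.\<close>
      have wp: "w [^] p = cmt x w"
        using two[of "w [^] p"] w w_neq True by simp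
      have "cmt x w \<otimes> cmt x w = \<one>"
        using Z_pow_p[OF xw] xw by (simp add: p numeral_2_eq_2)
      then have "(w \<otimes> x) [^] p = \<one>"
        using mult_square_p2[OF p w(1) x(1)] x w True by (simp add: wp)
      moreover have "cmt x (w \<otimes> x) = cmt x w" "cmt y (w \<otimes> x) = cmt y w"
        using x y w yx by (simp_all add: cmt_mult_right)
      ultimately show ?thesis
        using x y w True sq by (intro aut_orbit_via[of x y "w \<otimes> x"]) simp_all
    next
      case False
      \<comment> \<open>Now \<open>w^2 = 1\<close>, and \<open>w x\<close> squares to 1 too, so this
        correction does not help; the Siegel transformation takes over.\<close>
      have "x [^] p = cmt x w" using two[of "x [^] p"] x False by simp
      then have "w [^] p = \<one>" using two[of "w [^] p"] w w_neq by auto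
      then show ?thesis
        using aut_orbit_siegel[OF p x(1) y(1) w(1) \<open>cmt x y = \<one>\<close> sq] w by blast
    qed
  qed
qed

text \<open>If all squares were trivial, so would be the polar form of squaring, which is the
  commutator.\<close>

lemma ex_square_nontrivial:
  assumes p: "p = 2"
  shows "\<exists>x\<in>carrier G. x \<notin> Z \<and> x [^] p \<noteq> \<one>"
proof (rule ccontr)
  assume "\<not> ?thesis"
  then have sq: "x [^] p = \<one>" if "x \<in> carrier G" for x using that Z_pow_p by blast
  obtain x where x: "x \<in> carrier G" "x \<notin> Z" using ex_noncentral by blast
  then obtain y where y: "y \<in> carrier G" "cmt x y \<noteq> \<one>" using noncentral_cmt by blast
  have "cmt y x = \<one>" using mult_square_p2[OF p x(1) y(1)] sq x y by simp
  then show False using x y cmt_eq_one_commute[of x y] by simp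
qed

text \<open>\<open>Z\<close> has two elements, so triviality of \<open>x^2\<close> already
  determines \<open>x^2\<close>. There are 3 orbits, or 4 with noncentral involutions.\<close>

lemma num_impostors_p2:
  assumes p: "p = 2"
  shows "num_impostors G = (if \<exists>x\<in>carrier G. x \<notin> Z \<and> x [^] p = \<one> then 5 else 1)"
proof -
  define f where "f x = (x \<in> Z, x = \<one>, x [^] p = \<one>)" for x
  obtain z where z: "z \<in> Z" "z \<noteq> \<one>" using ex_nontrivial_Z by blast
  have "num_impostors G = 2 ^ (card (f ` carrier G) - 1) - 3"
  proof (rule num_impostors_eq)
    fix x y assume xy: "x \<in> carrier G" "y \<in> carrier G" and f: "f x = f y"
    show "aut_orbit x y"
    proof (cases "x \<in> Z")
      case True
      then show ?thesis using f by (intro aut_orbit_in_Z) (auto simp: f_def)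
    next
      case False
      have "x [^] p = y [^] p"
        using two_cases_Z[OF p z, of "x [^] p"] two_cases_Z[OF p z, of "y [^] p"] xy f
        by (auto simp: f_def)
      then show ?thesis using False xy f by (intro aut_orbit_p2[OF p]) (auto simp: f_def)
    qed
  qed (simp add: f_def iso_self_center iso_self_eq_one iso_self_pow_p_eq_one)
  moreover have "f ` carrier G = {(True, True, True), (True, False, True), (False, False, False)} \<union>
      (if \<exists>x\<in>carrier G. x \<notin> Z \<and> x [^] p = \<one> then {(False, False, True)} else {})" (is "_ = ?K \<union> ?E")
  proof -
    obtain x where x: "x \<in> carrier G" "x \<notin> Z" "x [^] p \<noteq> \<one>"
      using ex_square_nontrivial[OF p] by blast
    then have "x \<noteq> \<one>" by auto
    have "f \<one> = (True, True, True)" "f z = (True, False, True)" "f x = (False, False, False)"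
      using z x \<open>x \<noteq> \<one>\<close> by (simp_all add: f_def)
    then have "?K \<subseteq> f ` carrier G"
      using z x by (metis Z_closed empty_subsetI image_eqI insert_subset one_closed)
    moreover have "?E \<subseteq> f ` carrier G"
    proof (cases "\<exists>x\<in>carrier G. x \<notin> Z \<and> x [^] p = \<one>")
      case True
      then obtain v where v: "v \<in> carrier G" "v \<notin> Z" "v [^] p = \<one>" by blast
      then have "f v = (False, False, True)" by (auto simp: f_def)
      then have "(False, False, True) \<in> f ` carrier G" using v by (metis image_eqI)
      then show ?thesis using True by simp
    next
      case False
      then show ?thesis by (simp only: if_False empty_subsetI)
    qed
    moreover have "f v \<in> ?K \<union> ?E" if v: "v \<in> carrier G" for v
    proof (cases "v \<in> Z")
      case True
      then show ?thesis by (simp add: f_def)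
    next
      case False
      then have "v \<noteq> \<one>" by auto
      then show ?thesis using False v by (cases "v [^] p = \<one>") (auto simp: f_def)
    qed
    then have "f ` carrier G \<subseteq> ?K \<union> ?E" by (rule image_subsetI)
    ultimately show ?thesis by (intro subset_antisym Un_least)
  qed
  ultimately show ?thesis by (simp split: if_splits)
qed

section \<open>Recognition of the quaternion group\<close>

text \<open>By counting: \<open>v^2 = 1\<close> has at most two solutions in the quaternion group,
  and \<open>Z\<close> supplies two.\<close>

lemma no_noncentral_involution_if_quaternion:
  assumes p: "p = 2" and iso: "G \<cong> quaternion_group"
    and x: "x \<in> carrier G" "x [^] p = \<one>"
  shows "x \<in> Z"
proof -
  obtain h where h: "h \<in> iso G quaternion_group" using iso unfolding is_iso_def by blast
  have hom: "h (a \<otimes> b) = quat_mult (h a) (h b)" and car: "h a \<in> {0..<4} \<times> {0..<2}"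
    if "a \<in> carrier G" "b \<in> carrier G" for a b
    using h that by (auto simp: iso_def hom_def quaternion_group_def)
  have inj: "inj_on h (carrier G)" using h by (simp add: iso_def bij_betw_def)
  \<comment> \<open>The model enters only through \<open>quat_mult\<close>, so the image of the
    identity is recognised as its only idempotent.\<close>
  have one: "h \<one> = (0, 0)"
    using hom[of \<one> \<one>] car[of \<one> \<one>] by (cases "h \<one>") (auto simp: quat_mult_def split: if_splits; presburger)
  have sq: "h v \<in> {(0, 0), (2, 0)}" if "v \<in> carrier G" "v [^] p = \<one>" for v
  proof -
    obtain a b where ab: "h v = (a, b)" by force
    have "quat_mult (a, b) (a, b) = (0, 0)" "a < 4" "b < 2"
      using hom[of v v] car[of v v] that ab one by (simp_all add: p numeral_2_eq_2)
    then show ?thesis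
      unfolding ab by (auto simp: quat_mult_def split: if_splits; presburger)
  qed
  let ?S = "{v \<in> carrier G. v [^] p = \<one>}"
  have "card ?S = card (h ` ?S)"
    using inj by (intro card_image[symmetric]) (auto intro: inj_on_subset)
  also have "\<dots> \<le> card {(0::nat, 0::nat), (2, 0)}"
    using sq by (intro card_mono image_subsetI) simp_all
  finally have "card ?S \<le> card Z" by (simp add: card_Z p)
  moreover have "Z \<subseteq> ?S" by auto
  ultimately have "Z = ?S" by (intro card_seteq) auto
  then show ?thesis using x by blast
qed

text \<open>Noncommuting \<open>x\<close> and \<open>y\<close> must both square to \<open>z\<close>,
  which gives the quaternion relations. Nothing else fits: a noncentral \<open>d\<close> commuting
  with both would make \<open>d x\<close> a noncentral involution.\<close>

lemma quaternion_if_no_noncentral_involution: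
  assumes p: "p = 2" and no_inv: "\<And>x. \<lbrakk>x \<in> carrier G; x [^] p = \<one>\<rbrakk> \<Longrightarrow> x \<in> Z"
  shows "G \<cong> quaternion_group"
proof -
  obtain x where x [simp]: "x \<in> carrier G" and "x \<notin> Z" using ex_noncentral by blast
  then obtain y where y [simp]: "y \<in> carrier G" and xy: "cmt x y \<noteq> \<one>"
    using noncentral_cmt by blast
  have yx: "cmt y x \<noteq> \<one>" using xy cmt_eq_one_commute[of x y] by simp
  define z where "z = cmt x y"
  have z: "z \<in> Z" "z \<noteq> \<one>" using xy by (simp_all add: z_def)
  note two = two_cases_Z[OF p z]
  have noncentral_sq: "v [^] p = z" if "v \<in> carrier G" "w \<in> carrier G" "cmt v w \<noteq> \<one>" for v w
    using that no_inv[of v] two[of "v [^] p"] by auto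
  have xx: "x [^] (2::nat) = z" and yy: "y [^] (2::nat) = z"
    using noncentral_sq[of x y] noncentral_sq[of y x] xy yx by (simp_all add: p)
  have zz: "z [^] (2::nat) = \<one>" using Z_pow_p[OF z(1)] by (simp add: p)
  have yxz: "cmt y x = z" using two[of "cmt y x"] yx by simp
  have x4: "x [^] (4::nat) = \<one>"
  proof -
    have "x [^] (2 * 2 :: nat) = (x [^] (2::nat)) [^] (2::nat)" by (simp only: nat_pow_pow x)
    then show ?thesis by (simp add: xx zz)
  qed
  have "ord x dvd 4" "\<not> ord x dvd 2"
    using x4 xx z(2) pow_eq_id[OF x, of 4] pow_eq_id[OF x, of 2] by metis+
  moreover have "n \<in> {0, 1, 2, 3, 4}" if "n dvd 4" for n :: nat
    using dvd_imp_le[OF that] by auto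
  ultimately have ord_x: "ord x = 4" by fastforce
  have x_mod: "x [^] (n mod 4) = x [^] n" for n :: nat
  proof -
    have "x [^] (4 * (n div 4) + n mod 4) = (x [^] (4::nat)) [^] (n div 4) \<otimes> x [^] (n mod 4)"
      by (simp only: nat_pow_mult nat_pow_pow x)
    then show ?thesis by (simp add: x4)
  qed
  have y_pow: "\<exists>a b. b < 2 \<and> y [^] n = x [^] (a::nat) \<otimes> y [^] (b::nat)" for n :: nat
  proof -
    have "y [^] (2 * (n div 2) + n mod 2) = (y [^] (2::nat)) [^] (n div 2) \<otimes> y [^] (n mod 2)"
      by (simp only: nat_pow_mult nat_pow_pow y)
    then have "y [^] n = x [^] (2 * (n div 2)) \<otimes> y [^] (n mod 2)"
      by (simp add: yy nat_pow_pow flip: xx)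
    then show ?thesis by (intro exI[of _ "2 * (n div 2)"] exI[of _ "n mod 2"]) simp
  qed
  define h where "h = (\<lambda>(a, b). x [^] (a::nat) \<otimes> y [^] (b::nat))"
  let ?Q = "{0..<4} \<times> {0..<2} :: (nat \<times> nat) set"
  have h_closed: "h q \<in> carrier G" for q by (simp add: h_def split: prod.split)
  have surj: "\<exists>q\<in>?Q. g = h q" if g: "g \<in> carrier G" for g
  proof -
    obtain i j :: nat and d where d: "d \<in> carrier G" "cmt d x = \<one>" "cmt d y = \<one>" "g = x [^] i \<otimes> (y [^] j \<otimes> d)"
      using nondegenerate_commutant(3)[OF nondegenerate_carrier x y xy g] by blast
    have "d \<in> Z"
    proof (rule ccontr)
      assume "d \<notin> Z"
      then obtain w where w: "w \<in> carrier G" "cmt d w \<noteq> \<one>" using noncentral_cmt d(1) by blast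
      then have "d [^] p = z" using d noncentral_sq by blast
      moreover have "cmt x d = \<one>" using d cmt_eq_one_commute[of x d] by simp
      ultimately have "(d \<otimes> x) [^] p = z \<otimes> z"
        using mult_square_p2[OF p d(1) x] z xx by (simp add: p)
      then have "(d \<otimes> x) [^] p = \<one>" using zz z by (simp add: numeral_2_eq_2)
      then have "d \<otimes> x \<in> Z" using d(1) by (intro no_inv) simp_all
      then have "cmt (d \<otimes> x) y = \<one>" by simp
      then show False using d z by (simp add: cmt_mult_left z_def)
    qed
    then obtain k :: nat where k: "d = x [^] (2 * k)"
      using Z_powers[OF z, of d] xx nat_pow_pow[OF x, of 2] by metis
    obtain a b :: nat where ab: "b < 2" "y [^] j = x [^] a \<otimes> y [^] b" using y_pow by blast
    have "g = x [^] i \<otimes> (d \<otimes> y [^] j)" using d \<open>d \<in> Z\<close> Z_commute[of d "y [^] j"] by simp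
    also have "\<dots> = x [^] (i + 2 * k + a) \<otimes> y [^] b"
      by (simp add: k ab m_assoc flip: nat_pow_mult)
    also have "\<dots> = h ((i + 2 * k + a) mod 4, b)" by (simp add: h_def x_mod)
    finally show ?thesis using ab(1) by (intro bexI[of _ "((i + 2 * k + a) mod 4, b)"]) auto
  qed
  \<comment> \<open>The commutator with \<open>x\<close> recovers \<open>b\<close> from
    \<open>h (a, b)\<close>; then \<open>a\<close> follows from \<open>ord x = 4\<close>.\<close>
  have cmt_h: "cmt (x [^] a \<otimes> y [^] b) x = z [^] b" for a b :: nat
    using z by (simp add: cmt_mult_left cmt_pow_left yxz)
  have inj: "inj_on h ?Q"
  proof (intro inj_onI; clarify)
    fix a b c d :: nat
    assume Q: "a \<in> {0..<4}" "b \<in> {0..<2}" "c \<in> {0..<4}" "d \<in> {0..<2}" and eq: "h (a, b) = h (c, d)"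
    have "z [^] b = cmt (h (a, b)) x" by (simp add: h_def cmt_h)
    also have "\<dots> = z [^] d" unfolding eq by (simp add: h_def cmt_h)
    finally have bd: "b = d" using Z_powers_inj[OF z, of b d] Q p by simp
    then have "x [^] a = x [^] c" using eq by (simp add: h_def)
    moreover have "inj_on (\<lambda>n. x [^] n) {0..ord x - 1}" by (intro ord_inj) simp
    ultimately have "a = c" using Q by (auto simp: ord_x dest: inj_onD[of _ _ a c])
    then show "a = c \<and> b = d" using bd by simp
  qed
  \<comment> \<open>Conjugation by \<open>y\<close> inverts \<open>x\<close>, written with exponent
    3 for -1; the extra \<open>x^(2c)\<close> is \<open>[y, x]^c = z^c\<close>.\<close>
  have yx_pow: "y \<otimes> x [^] c = x [^] (3 * c) \<otimes> y" for c :: nat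
  proof -
    have "y \<otimes> x [^] c = cmt y (x [^] c) \<otimes> (x [^] c \<otimes> y)" by (intro cmt_mult) simp_all
    also have "cmt y (x [^] c) = x [^] (2 * c)"
      by (simp add: cmt_pow_right yxz nat_pow_pow flip: xx)
    also have "x [^] (2 * c) \<otimes> (x [^] c \<otimes> y) = x [^] (2 * c + c) \<otimes> y"
      using nat_pow_mult[of x "2 * c" c] by (simp flip: m_assoc)
    finally show ?thesis by simp
  qed
  have x_cong: "x [^] m = x [^] n" if "m mod 4 = n mod 4" for m n :: nat
    using x_mod[of m] x_mod[of n] that by simp
  have hom: "h (quat_mult q r) = h q \<otimes> h r" if q: "q \<in> ?Q" and r: "r \<in> ?Q" for q r
  proof -
    obtain a b c d where qr: "q = (a, b)" "r = (c, d)" and lt: "a < 4" "b < 2" "c < 4" "d < 2"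
      using q r by auto
    \<comment> \<open>Reconciles \<open>3c\<close> with the form \<open>a + 4 - c\<close> used in
      \<open>quat_mult\<close>, where the 4 keeps the subtraction from being truncated.\<close>
    have shift: "x [^] (a + 3 * c + k) = x [^] (a + 4 - c + k)" for k
    proof (rule x_cong)
      have "a + 3 * c + k + 4 = (a + 4 - c + k) + 4 * c" using lt by simp
      then have "(a + 3 * c + k + 4) mod 4 = ((a + 4 - c + k) + 4 * c) mod 4" by (rule arg_cong)
      then show "(a + 3 * c + k) mod 4 = (a + 4 - c + k) mod 4"
        by (simp only: mod_add_self2 mod_mult_self2)
    qed
    consider "b = 0" | "b = 1" "d = 0" | "b = 1" "d = 1" using lt by linarith
    then show ?thesis
    proof cases
      case 1
      then show ?thesis by (simp add: qr h_def quat_mult_def x_mod m_assoc flip: nat_pow_mult)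
    next
      case 2
      have "h q \<otimes> h r = x [^] a \<otimes> (y \<otimes> x [^] c)" by (simp add: qr h_def 2 m_assoc)
      also have "\<dots> = x [^] (a + 3 * c) \<otimes> y"
        unfolding yx_pow by (simp add: m_assoc flip: nat_pow_mult)
      finally show ?thesis using shift[of 0] by (simp add: qr h_def quat_mult_def 2 x_mod)
    next
      case 3
      have "h q \<otimes> h r = x [^] a \<otimes> (y \<otimes> x [^] c) \<otimes> y" by (simp add: qr h_def 3 m_assoc)
      also have "\<dots> = x [^] (a + 3 * c) \<otimes> (y \<otimes> y)"
        unfolding yx_pow by (simp add: m_assoc flip: nat_pow_mult)
      also have "y \<otimes> y = x [^] (2::nat)" using xx yy by (simp add: numeral_2_eq_2)
      also have "x [^] (a + 3 * c) \<otimes> x [^] (2::nat) = x [^] (a + 3 * c + 2)"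
        by (intro nat_pow_mult) simp
      finally show ?thesis using shift[of 2] by (simp only: qr h_def quat_mult_def 3) (simp add: x_mod)
    qed
  qed
  have closed: "quat_mult q r \<in> ?Q" if "q \<in> ?Q" "r \<in> ?Q" for q r
    using that by (auto simp: quat_mult_def split: prod.splits)
  have bij: "bij_betw h ?Q (carrier G)"
    unfolding bij_betw_def using inj surj h_closed by blast
  define k where "k = inv_into ?Q h"
  have k_bij: "bij_betw k (carrier G) ?Q" unfolding k_def using bij by (rule bij_betw_inv_into)
  have k_h: "k (h q) = q" if "q \<in> ?Q" for q unfolding k_def using inj that by (rule inv_into_f_f)
  have k_mult: "k (g \<otimes> g') = quat_mult (k g) (k g')" if g: "g \<in> carrier G" "g' \<in> carrier G" for g g'
  proof -
    obtain q r where "q \<in> ?Q" "g = h q" "r \<in> ?Q" "g' = h r" using surj g by meson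
    then show ?thesis using k_h closed by (simp only: hom[symmetric])
  qed
  have "k \<in> iso G quaternion_group"
    using k_bij k_mult bij_betwE[OF k_bij] by (simp add: iso_def hom_def quaternion_group_def Pi_iff)
  then show ?thesis unfolding is_iso_def by blast
qed

text \<open>The exponent is only tested, not computed: if all \<open>p\<close>-th powers are trivial
  it divides \<open>p\<close>; otherwise it is a multiple of an element order that does not divide
  \<open>p\<close>.\<close>

lemma exponent_p_cases:
  "(\<forall>x\<in>carrier G. x [^] p = \<one>) \<and> group_exponent G \<noteq> p ^ 2 \<or>
   (\<exists>x\<in>carrier G. x [^] p \<noteq> \<one>) \<and> group_exponent G \<noteq> p"
proof (cases "\<forall>x\<in>carrier G. x [^] p = \<one>")
  case True
  then have "group_exponent G dvd p"
    unfolding group_exponent_def by (auto intro!: Lcm_least simp flip: pow_eq_id)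
  moreover have "\<not> p ^ 2 dvd p"
    using p_gt_1 by (auto dest: dvd_imp_le simp: power2_eq_square)
  ultimately show ?thesis using True by auto
next
  case False
  then obtain x where x: "x \<in> carrier G" "x [^] p \<noteq> \<one>" by blast
  have "ord x dvd group_exponent G" unfolding group_exponent_def using x by (intro dvd_Lcm) simp
  moreover have "\<not> ord x dvd p" using x pow_eq_id[of x p] by simp
  ultimately show ?thesis using x by auto
qed

end

theorem theorem4p10:
  fixes p :: nat and G :: "('a, 'b) monoid_scheme"
  assumes "Factorial_Ring.prime p" and "extraspecial_p_group p G"
  shows "(p = 2 \<longrightarrow>
            (G \<cong> quaternion_group \<longrightarrow> num_impostors G = 1) \<and>
            (\<not> G \<cong> quaternion_group \<longrightarrow> num_impostors G = 5))
       \<and> (odd p \<longrightarrow>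
            (group_exponent G = p \<longrightarrow> num_impostors G = 1) \<and>
            (group_exponent G = p\<^sup>2 \<and> order G = p ^ 3 \<longrightarrow> num_impostors G = 2 ^ (p + 1) - 3) \<and>
            (group_exponent G = p\<^sup>2 \<and> order G > p ^ 3 \<longrightarrow> num_impostors G = 2 ^ (p + 2) - 3))"
proof -
  have "group G"
    using assms(2) by (simp add: extraspecial_p_group_def special_p_group_def p_group_def)
  then interpret extraspecial G p
    using assms by (simp add: extraspecial_def extraspecial_axioms_def)
  have "G \<cong> quaternion_group \<longleftrightarrow> \<not> (\<exists>x\<in>carrier G. x \<notin> Z \<and> x [^]\<^bsub>G\<^esub> p = \<one>\<^bsub>G\<^esub>)" if "p = 2"
    using no_noncentral_involution_if_quaternion[OF that] quaternion_if_no_noncentral_involution[OF that]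
    by blast
  then show ?thesis
    using num_impostors_p2 num_impostors_exponent_p num_impostors_exponent_p2 exponent_p_cases by auto
qed

end
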